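(* Model the online label shift problem (see context) as the SEA model with expected functions $F_t(\mathbf{x})=\sum_{k=1}^K[\boldsymbol\mu_{y_t}]_kF_0^k(\mathbf{x})$ and random functions $f_t(\mathbf{x})=\sum_{k=1}^K[\hat{\boldsymbol\mu}_{y_t}]_kf_0^k(\mathbf{x})$, and run the two-layer algorithm with implicit updates described in the context on $f_1,\dots,f_T$. Then for $\mathbf{x}_t^*\in\arg\min_{\mathbf{x}\in\mathcal{X}}F_t(\mathbf{x})$, $$\mathbb{E}\Big[\sum_{t=1}^Tf_t(\mathbf{x}_t)-\sum_{t=1}^Tf_t(\mathbf{x}_t^* )\Big]\le\mathcal{O}\left(L_T^{1/3}T^{1/3}\left(\sqrt{\sum_{t=1}^T\mathbb{E}\big[\|\hat{\boldsymbol\mu}_{y_t}-\boldsymbol\mu_{y_t}\|_2^2\big]}+\sqrt{\sum_{t=1}^T\mathbb{E}\big[\|\boldsymbol\mu_{y_t}-\boldsymbol\mu_{y_{t-1}}\|_2^2\big]}\right)^{2/3}\right),$$ where $L_T=\sum_{t=2}^T\|\boldsymbol\mu_{y_t}-\boldsymbol\mu_{y_{t-1}}\|_1$ measures the changes of the label distributions.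
   Context: SEA (Stochastically Extended Adversarial) model: in each round $t\in[T]=\{1,\dots,T\}$ the learner selects $\mathbf{x}_t$ from a convex set $\mathcal{X}$, a random function $f_t$ with (conditional) expectation $F_t$ is drawn, and the learner suffers $f_t(\mathbf{x}_t)$ and observes $f_t$. Online label shift: $\mathcal{Z}\subseteq\mathbb{R}^{d'}$ is the feature space, $\mathcal{Y}=[K]=\{1,\dots,K\}$ the label space, $\mathcal{X}\subseteq\mathbb{R}^d$ the convex set of model parameters. For each $t\in\{0,1,\dots,T\}$ there is a distribution $\mathfrak{D}_t(\mathbf{z},y)$ on $\mathcal{Z}\times\mathcal{Y}$; the class-conditional distribution $\mathfrak{D}_t(\mathbf{z}\mid y)$ is the same for all $t$, while the label distribution vector $\boldsymbol\mu_{y_t}\in\Delta_K$, $[\boldsymbol\mu_{y_t}]_k=\mathfrak{D}_t(y=k)$, may change ($\Delta_K$ is the probability simplex). With prediction function $h(\mathbf{x},\mathbf{z})$ and convex surrogate loss $\ell$, let $F_0^k(\mathbf{x})=\mathbb{E}_{\mathbf{z}\sim\mathfrak{D}_0(\mathbf{z}\mid y=k)}[\ell(h(\mathbf{x},\mathbf{z}),k)]$, so the risk at round $t$ is $F_t(\mathbf{x})=\mathbb{E}_{(\mathbf{z},y)\sim\mathfrak{D}_t}[\ell(h(\mathbf{x},\mathbf{z}),y)]=\sum_k[\boldsymbol\mu_{y_t}]_kF_0^k(\mathbf{x})$. Offline there is a labeled sample $S_0$ drawn from $\mathfrak{D}_0$ and an initial classifier $h_0:\mathcal{Z}\to\mathcal{Y}$;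 $f_0^k(\mathbf{x})$ is the average of $\ell(h(\mathbf{x},\mathbf{z}_n),k)$ over the samples in $S_0$ with label $k$. In round $t\in[T]$ the learner receives unlabeled data $S_t$ drawn from $\mathfrak{D}_t(\mathbf{z})$. Let $[C_{h_0}]_{ij}=\mathbb{E}_{\mathbf{z}\sim\mathfrak{D}_0(\mathbf{z}\mid y=j)}[\mathbf{1}\{h_0(\mathbf{z})=i\}]$ be the (invertible) confusion matrix, $\hat C_{h_0}$ its empirical version from $S_0$, $[\hat{\boldsymbol\mu}_{\hat y_t}]_j=\frac1{|S_t|}\sum_{\mathbf{z}\in S_t}\mathbf{1}\{h_0(\mathbf{z})=j\}$, and $\hat{\boldsymbol\mu}_{y_t}=\hat C_{h_0}^{-1}\hat{\boldsymbol\mu}_{\hat y_t}$. It is assumed that $S_0$ has sufficiently many samples that $\hat C_{h_0}=C_{h_0}$ and $f_0^k=F_0^k$ for all $k$; hence $f_t(\mathbf{x})$ is an unbiased estimator of $F_t(\mathbf{x})$. Standing assumptions: $\mathbf 0\in\mathcal X$ and $\mathcal X$ has diameter at most $D$; each $f_t$ is convex on $\mathcal{X}$ with $\|\nabla f_t(\mathbf{x})\|_2\le G$ on $\mathcal{X}$; $\|\nabla F_0^k(\mathbf{x})\|_2\le G$ on $\mathcal X$ for all $k$; and $B=\sup_{(\mathbf{z},y)\in\mathcal{Z}\times\mathcal{Y},\,\mathbf{x}\in\mathcal{X}}|\ell(h(\mathbf{x},\mathbf{z}),y)|$ is finite. Algorithm: let $N=\lceil\frac12\log_2((1+2T)(1+4TG^2))\rceil+1$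 and $\eta_i=\frac{D}{\sqrt{1+4TG^2}}2^{i-1}$, $i\in[N]$. Initialize $\mathbf{x}_{1,i}=\hat{\mathbf{x}}_{1,i}\in\mathcal{X}$ and $p_{1,i}=1/N$. In round $t$ play $\mathbf{x}_t=\sum_ip_{t,i}\mathbf{x}_{t,i}$; then update $\hat{\mathbf{x}}_{t+1,i}=\Pi_{\mathcal{X}}[\hat{\mathbf{x}}_{t,i}-\eta_i\nabla f_t(\mathbf{x}_{t,i})]$ ($\Pi_{\mathcal X}$ is Euclidean projection), $\mathbf{x}_{t+1,i}=\arg\min_{\mathbf{x}\in\mathcal{X}}f_t(\mathbf{x})+\frac1{2\eta_i}\|\mathbf{x}-\hat{\mathbf{x}}_{t+1,i}\|_2^2$, and weights in the probability simplex $p_{t+1,i}\propto\exp\big(-\epsilon_t\big(\sum_{s=1}^tf_s(\mathbf{x}_{s,i})+f_t(\mathbf{x}_{t+1,i})\big)\big)$, with $\epsilon_t=\big(1+\sum_{s=1}^t(\max_{i\in[N]}|\tilde f_s(\mathbf{x}_{s,i})-\tilde f_{s-1}(\mathbf{x}_{s,i})|)^2\big)^{-1/2}$, where $\tilde f_s(\mathbf{x})=f_s(\mathbf{x})-f_s(\mathbf{x}_{\mathrm{ref}})$ for an arbitrary fixed $\mathbf{x}_{\mathrm{ref}}\in\mathcal{X}$ and the function with index $0$ in this recursion is taken to be $0$. The $\mathcal{O}$-notation hides constants depending on $D,G,B,K$ and factors of $\ln N$ (of order $\log\log T$).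
   Formalization: The O-bound is stated for L_T ≥ δ and (sum of the two square roots) ≥ δ with any δ > 0, the hidden constant also depending on δ; without this it fails, e.g. for constant label distributions L_T = 0 makes the bound zero while the regret can be positive. *)

theory Defs
  imports "HOL-Probability.Probability"
begin

section \<open>Online label shift\<close>

text \<open>
  Labels form a finite type \<open>'k\<close>, so that \<open>K = CARD('k)\<close>. A joint distribution \<open>P\<close> of a feature
  and a label is a measure on pairs; its features live in the measurable space \<open>feature_space Z\<close>.
\<close>

definition feature_space :: "'z::topological_space set \<Rightarrow> 'z measure" where
  "feature_space Z = restrict_space borel Z"

definition label_vec :: "('z \<times> 'k::finite) measure \<Rightarrow> real ^ 'k" where
  "label_vec P = (\<chi> k. measure P {w \<in> space P. snd w = k})"

text \<open>The law of the feature given the label \<open>k\<close>; meaningful only if \<open>k\<close> has positive probability.\<close>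

definition class_cond ::
  "'z::topological_space set \<Rightarrow> ('z \<times> 'k) measure \<Rightarrow> 'k \<Rightarrow> 'z measure" where
  "class_cond Z P k =
     distr (uniform_measure P {w \<in> space P. snd w = k}) (feature_space Z) fst"

definition class_risk ::
  "'z::topological_space set \<Rightarrow> ('z \<times> 'k) measure \<Rightarrow> ('a \<Rightarrow> 'z \<Rightarrow> 'p) \<Rightarrow> ('p \<Rightarrow> 'k \<Rightarrow> real)
     \<Rightarrow> 'k \<Rightarrow> 'a \<Rightarrow> real" where
  "class_risk Z P h l k x = (\<integral>z. l (h x z) k \<partial>class_cond Z P k)"

definition confusion ::
  "'z::topological_space set \<Rightarrow> ('z \<times> 'k::finite) measure \<Rightarrow> ('z \<Rightarrow> 'k) \<Rightarrow> real ^ 'k ^ 'k" where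
  "confusion Z P h0 = (\<chi> i j. \<integral>z. of_bool (h0 z = i) \<partial>class_cond Z P j)"

definition label_samples :: "('z \<times> 'k) list \<Rightarrow> 'k \<Rightarrow> 'z list" where
  "label_samples S0 k = map fst (filter (\<lambda>w. snd w = k) S0)"

definition class_avg ::
  "('z \<times> 'k) list \<Rightarrow> ('a \<Rightarrow> 'z \<Rightarrow> 'p) \<Rightarrow> ('p \<Rightarrow> 'k \<Rightarrow> real) \<Rightarrow> 'k \<Rightarrow> 'a \<Rightarrow> real" where
  "class_avg S0 h l k x =
     (\<Sum>z\<leftarrow>label_samples S0 k. l (h x z) k) / real (length (label_samples S0 k))"

definition pred_freq :: "('z \<Rightarrow> 'k::finite) \<Rightarrow> 'z list \<Rightarrow> real ^ 'k" where
  "pred_freq h0 S = (\<chi> j. (\<Sum>z\<leftarrow>S. of_bool (h0 z = j)) / real (length S))"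

definition emp_confusion :: "('z \<times> 'k::finite) list \<Rightarrow> ('z \<Rightarrow> 'k) \<Rightarrow> real ^ 'k ^ 'k" where
  "emp_confusion S0 h0 = (\<chi> i j. pred_freq h0 (label_samples S0 j) $ i)"

definition label_est ::
  "('z \<times> 'k::finite) list \<Rightarrow> ('z \<Rightarrow> 'k) \<Rightarrow> 'z list \<Rightarrow> real ^ 'k" where
  "label_est S0 h0 S = matrix_inv (emp_confusion S0 h0) *v pred_freq h0 S"

definition expected_fun ::
  "'z::topological_space set \<Rightarrow> (nat \<Rightarrow> ('z \<times> 'k::finite) measure) \<Rightarrow> ('a \<Rightarrow> 'z \<Rightarrow> 'p)
     \<Rightarrow> ('p \<Rightarrow> 'k \<Rightarrow> real) \<Rightarrow> nat \<Rightarrow> 'a \<Rightarrow> real" where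
  "expected_fun Z P h l t x = (\<Sum>k\<in>UNIV. label_vec (P t) $ k * class_risk Z (P 0) h l k x)"

definition random_fun ::
  "('z \<times> 'k::finite) list \<Rightarrow> ('z \<Rightarrow> 'k) \<Rightarrow> ('a \<Rightarrow> 'z \<Rightarrow> 'p) \<Rightarrow> ('p \<Rightarrow> 'k \<Rightarrow> real)
     \<Rightarrow> 'z list \<Rightarrow> 'a \<Rightarrow> real" where
  "random_fun S0 h0 h l S x = (\<Sum>k\<in>UNIV. label_est S0 h0 S $ k * class_avg S0 h l k x)"

definition norm1 :: "real ^ 'k::finite \<Rightarrow> real" where
  "norm1 v = (\<Sum>k\<in>UNIV. \<bar>v $ k\<bar>)"

definition gradient :: "('a::real_inner \<Rightarrow> real) \<Rightarrow> 'a \<Rightarrow> 'a" where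
  "gradient f x = (THE g. GDERIV f x :> g)"

text \<open>The gradient is unspecified at points of non-differentiability, hence the first conjunct.\<close>

definition gradient_bounded_on :: "'a::real_inner set \<Rightarrow> real \<Rightarrow> ('a \<Rightarrow> real) \<Rightarrow> bool" where
  "gradient_bounded_on X G f \<longleftrightarrow>
     (\<forall>x\<in>X. f differentiable (at x) \<and> norm (gradient f x) \<le> G)"

section \<open>The two-layer algorithm with implicit updates\<close>

definition num_experts :: "nat \<Rightarrow> real \<Rightarrow> nat" where
  "num_experts T G =
     nat \<lceil>1 / 2 * log 2 ((1 + 2 * real T) * (1 + 4 * real T * G\<^sup>2))\<rceil> + 1"

definition step_size :: "nat \<Rightarrow> real \<Rightarrow> real \<Rightarrow> nat \<Rightarrow> real" where
  "step_size T G D i = D / sqrt (1 + 4 * real T * G\<^sup>2) * 2 ^ (i - 1)"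

definition ref_loss :: "(nat \<Rightarrow> 'a \<Rightarrow> real) \<Rightarrow> 'a \<Rightarrow> nat \<Rightarrow> 'a \<Rightarrow> real" where
  "ref_loss f xref s x = (if s = 0 then 0 else f s x - f s xref)"

definition meta_rate ::
  "nat \<Rightarrow> (nat \<Rightarrow> 'a \<Rightarrow> real) \<Rightarrow> 'a \<Rightarrow> (nat \<Rightarrow> nat \<Rightarrow> 'a) \<Rightarrow> nat \<Rightarrow> real" where
  "meta_rate N f xref x t =
     1 / sqrt (1 + (\<Sum>s=1..t.
       (MAX i\<in>{1..N}. \<bar>ref_loss f xref s (x s i) - ref_loss f xref (s - 1) (x s i)\<bar>)\<^sup>2))"

text \<open>
  \<open>two_layer_run X D G T xref f x xh p\<close>: the base iterates \<open>x t i\<close>, the projected iterates \<open>xh t i\<close>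
  and the weights \<open>p t i\<close> are those of a run on the losses \<open>f 1, \<dots>, f T\<close>. Since \<open>X\<close> need not be
  closed, projection and implicit update are expressed by \<^const>\<open>is_arg_min\<close>, which asserts that the
  minimisers exist; for convex losses they are unique by strict convexity.
\<close>

definition two_layer_run ::
  "'a::euclidean_space set \<Rightarrow> real \<Rightarrow> real \<Rightarrow> nat \<Rightarrow> 'a \<Rightarrow> (nat \<Rightarrow> 'a \<Rightarrow> real)
     \<Rightarrow> (nat \<Rightarrow> nat \<Rightarrow> 'a) \<Rightarrow> (nat \<Rightarrow> nat \<Rightarrow> 'a) \<Rightarrow> (nat \<Rightarrow> nat \<Rightarrow> real) \<Rightarrow> bool" where
  "two_layer_run X D G T xref f x xh p \<longleftrightarrow>
     (let N = num_experts T G; \<eta> = step_size T G D;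
          w = (\<lambda>t i. exp (- meta_rate N f xref x t *
                       ((\<Sum>s=1..t. f s (x s i)) + f t (x (t + 1) i))))
      in (\<forall>i\<in>{1..N}. x 1 i \<in> X \<and> xh 1 i = x 1 i \<and> p 1 i = 1 / real N) \<and>
         (\<forall>t\<in>{1..T}. \<forall>i\<in>{1..N}.
            is_arg_min (\<lambda>y. norm (y - (xh t i - \<eta> i *\<^sub>R gradient (f t) (x t i))))
              (\<lambda>y. y \<in> X) (xh (t + 1) i) \<and>
            is_arg_min (\<lambda>y. f t y + 1 / (2 * \<eta> i) * (norm (y - xh (t + 1) i))\<^sup>2)
              (\<lambda>y. y \<in> X) (x (t + 1) i) \<and>
            p (t + 1) i = w t i / (\<Sum>j=1..N. w t j)))"

definition played :: "nat \<Rightarrow> (nat \<Rightarrow> 'a::real_vector) \<Rightarrow> (nat \<Rightarrow> real) \<Rightarrow> 'a" where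
  "played N x p = (\<Sum>i=1..N. p i *\<^sub>R x i)"

section \<open>The constant hidden in the asymptotic bound\<close>

text \<open>
  An existentially quantified constant could depend on all type parameters of the theorem, in
  particular on the dimensions of the parameter and feature spaces. An explicit (not optimised)
  constant rules this out. The number \<open>\<delta>\<close> is a positive lower bound for the two quantities, besides
  the horizon, in which the bound is asymptotic: the total change of the label vectors and the sum of
  the two square roots. Without it no constant works: if the label vectors never change, the bound is
  zero while the expected regret need not be.
\<close>

definition ols_const :: "real \<Rightarrow> real \<Rightarrow> real \<Rightarrow> nat \<Rightarrow> real \<Rightarrow> nat \<Rightarrow> real" where
  "ols_const D G B K \<delta> N =
     1000 * (1 + D)\<^sup>2 * (1 + G)\<^sup>2 * (1 + B) * real K * (1 + 1 / \<delta>) * (1 + ln (real N))"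

end

theory Submission
  imports Defs
begin

text \<open>
  By the optimality condition of the implicit update, each expert runs optimistic mirror descent with
  hint \<open>\<nabla>f (t - 1) (x t)\<close>, evaluated at the iterate of round \<open>t\<close> itself. Without any smoothness, its
  regret against comparators with \<open>n\<close> constant pieces is therefore of order \<open>sqrt (n * (1 + W))\<close>, where
  \<open>W\<close> is the sum over \<open>t\<close> of the squared suprema of \<open>\<nabla>f t - \<nabla>f (t - 1)\<close>. Optimistic hedge, which
  combines the experts, loses another \<open>sqrt (1 + W)\<close>, and \<open>W\<close> has expectation of order \<open>1 + V\<^sup>2\<close>. Restarting
  the comparator at a minimiser of \<open>F\<close> every \<open>\<Delta>\<close> rounds costs at most \<open>2 * B * \<Delta> * L\<close>; the choice
  \<open>\<Delta> = (T * V\<^sup>2 / L\<^sup>2) powr (1/3)\<close>, rounded up, balances the two terms.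
\<close>

section \<open>Gradients on convex sets\<close>

text \<open>Regret is bounded separately for each outcome, on the realised losses, so only two
  quantities have to be averaged: the gradient variation \<open>W\<close> and the price of replacing
  \<open>xstar t\<close> by a block comparator. The latter is linear in the label estimates with
  non-random coefficients, so unbiasedness turns it into a difference of values of
  \<open>F t\<close>; this is why the block comparator is built from minimisers of expected
  functions and must not depend on the outcome. The former is tractable because all losses combine
  the same class risks: gradients of consecutive losses differ by at most \<open>G\<close> times the
  1-norm of the change of the estimate, uniformly on \<open>X\<close>. Passing through the true
  label vectors splits this change into estimation errors and drift, the two sums in
  \<open>V\<close>, and Jensen's inequality averages the root. Two lower-order effects must be
  absorbed into the rate \<open>R\<close>, the cube root of \<open>L * T * V^2\<close>. Additive
  constants are multiplied by \<open>R / \<delta>\<close> or \<open>V / \<delta>\<close>, both at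
  least 1. Rounding the block length up costs an extra \<open>L\<close>, which is at most
  \<open>K * R\<close> because Cauchy-Schwarz bounds \<open>L^2\<close> by
  \<open>K * T * V^2\<close>.\<close>

lemma GDERIV_imp_gradient:
  fixes f :: "'a::real_inner \<Rightarrow> real"
  assumes "GDERIV f x :> g"
  shows "gradient f x = g"
  unfolding gradient_def
proof (rule the_equality)
  show "GDERIV f x :> g"
    by fact
next
  fix g' assume "GDERIV f x :> g'"
  with assms have "(\<lambda>h. inner h g') = (\<lambda>h. inner h g)"
    unfolding gderiv_def by (rule has_derivative_unique[rotated])
  then have "inner (g' - g) g' = inner (g' - g) g"
    by metis
  then show "g' = g"
    by (metis inner_diff_right inner_eq_zero_iff eq_iff_diff_eq_0)
qed

lemma GDERIV_gradient:
  fixes f :: "'a::euclidean_space \<Rightarrow> real"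
  assumes "f differentiable (at x)"
  shows "GDERIV f x :> gradient f x"
proof -
  obtain f' where f': "(f has_derivative f') (at x)"
    using assms unfolding differentiable_def by blast
  \<comment> \<open>Riesz representation: the adjoint of the derivative, applied to 1, is the
    gradient.\<close>
  have "f' h = inner h (adjoint f' (1::real))" for h
    using adjoint_works[OF has_derivative_linear[OF f'], of h "1::real"] by (simp add: inner_commute)
  then have "f' = (\<lambda>h. inner h (adjoint f' (1::real)))"
    by (rule ext)
  then have "GDERIV f x :> adjoint f' (1::real)"
    using f' unfolding gderiv_def by simp
  then show ?thesis
    using GDERIV_imp_gradient by metis
qed

lemma GDERIV_cmult:
  assumes "GDERIV f x :> g"
  shows "GDERIV (\<lambda>y. c * f y) x :> c *\<^sub>R g"
  using GDERIV_mult[OF GDERIV_const assms, of c] by simp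

lemma GDERIV_sum:
  assumes "\<And>i. i \<in> I \<Longrightarrow> GDERIV (f i) x :> g i"
  shows "GDERIV (\<lambda>y. \<Sum>i\<in>I. f i y) x :> (\<Sum>i\<in>I. g i)"
  using assms unfolding gderiv_def inner_sum_right by (rule has_derivative_sum)

lemma GDERIV_norm_diff_square:
  "GDERIV (\<lambda>y. (norm (y - c))\<^sup>2) z :> 2 *\<^sub>R (z - c)"
  unfolding gderiv_def power2_norm_eq_inner
  by (auto intro!: derivative_eq_intros simp: inner_commute)

text \<open>The limit is taken from the right only: at a boundary point of a convex set, just the
  small positive steps towards another point of the set stay inside it.\<close>

lemma GDERIV_segment:
  assumes "GDERIV f x :> g"
  shows "((\<lambda>s. (f (x + s *\<^sub>R d) - f x) / s) \<longlongrightarrow> inner g d) (at_right 0)"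
proof -
  have "((\<lambda>s::real. x + s *\<^sub>R d) has_derivative (\<lambda>s. s *\<^sub>R d)) (at 0)"
    by (auto intro!: derivative_eq_intros)
  moreover have "(f has_derivative (\<lambda>h. inner h g)) (at (x + 0 *\<^sub>R d))"
    using assms by (simp add: gderiv_def)
  ultimately have "((\<lambda>s::real. f (x + s *\<^sub>R d)) has_derivative (\<lambda>s. inner (s *\<^sub>R d) g)) (at 0)"
    by (rule has_derivative_compose)
  then have "((\<lambda>s::real. f (x + s *\<^sub>R d)) has_real_derivative inner g d) (at 0)"
    unfolding has_field_derivative_def
    by (rule has_derivative_eq_rhs) (simp add: inner_commute mult.commute fun_eq_iff)
  then have "((\<lambda>s. (f (x + s *\<^sub>R d) - f x) / s) \<longlongrightarrow> inner g d) (at 0)"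
    by (simp add: has_field_derivative_iff)
  then show ?thesis
    by (rule tendsto_within_subset) auto
qed

lemma first_order_minimum:
  assumes "is_arg_min f (\<lambda>y. y \<in> X) z" "convex X" "GDERIV f z :> g" "y \<in> X"
  shows "0 \<le> inner g (y - z)"
proof (rule tendsto_lowerbound[OF GDERIV_segment[OF assms(3)]])
  have z: "z \<in> X" "\<And>w. w \<in> X \<Longrightarrow> f z \<le> f w"
    using assms(1) unfolding is_arg_min_def by force+
  have "0 \<le> (f (z + s *\<^sub>R (y - z)) - f z) / s" if "s \<in> {0<..<1}" for s
  proof -
    have "z + s *\<^sub>R (y - z) = (1 - s) *\<^sub>R z + s *\<^sub>R y"
      by (simp add: algebra_simps)
    also have "\<dots> \<in> X"
      using that z assms by (intro convexD) auto
    finally show ?thesis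
      using that z by simp
  qed
  then show "\<forall>\<^sub>F s in at_right 0. 0 \<le> (f (z + s *\<^sub>R (y - z)) - f z) / s"
    by (intro eventually_at_rightI[of 0 1]) auto
qed simp

lemma convex_gradient_inequality:
  assumes "convex_on X f" "GDERIV f x :> g" "x \<in> X" "y \<in> X"
  shows "f x - f y \<le> inner g (x - y)"
proof -
  have "inner g (y - x) \<le> f y - f x"
  proof (rule tendsto_upperbound[OF GDERIV_segment[OF assms(2)]])
    have "(f (x + s *\<^sub>R (y - x)) - f x) / s \<le> f y - f x" if "s \<in> {0<..<1}" for s
    proof -
      have "x + s *\<^sub>R (y - x) = (1 - s) *\<^sub>R x + s *\<^sub>R y"
        by (simp add: algebra_simps)
      then have "f (x + s *\<^sub>R (y - x)) \<le> (1 - s) * f x + s * f y"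
        using convex_onD[OF assms(1), of s x y] that assms by simp
      then show ?thesis
        using that by (simp add: field_simps)
    qed
    then show "\<forall>\<^sub>F s in at_right 0. (f (x + s *\<^sub>R (y - x)) - f x) / s \<le> f y - f x"
      by (intro eventually_at_rightI[of 0 1]) auto
  qed simp
  then show ?thesis
    by (simp add: inner_diff_right)
qed

text \<open>The gradient field \<open>g\<close> is left free because the lemma also serves for the
  difference of two consecutive losses, whose gradients are close although neither is small.\<close>

lemma gradient_bound_lipschitz:
  fixes f :: "'a::real_inner \<Rightarrow> real"
  assumes "convex X" "\<And>y. y \<in> X \<Longrightarrow> GDERIV f y :> g y" "\<And>y. y \<in> X \<Longrightarrow> norm (g y) \<le> a"
    and "x \<in> X" "y \<in> X"
  shows "\<bar>f x - f y\<bar> \<le> a * norm (x - y)"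
proof -
  have "norm (f x - f y) \<le> a * norm (x - y)"
  proof (rule differentiable_bound)
    show "(f has_derivative (\<lambda>h. inner h (g w))) (at w within X)" if "w \<in> X" for w
      using assms(2)[OF that] unfolding gderiv_def by (rule has_derivative_at_withinI)
    show "onorm (\<lambda>h. inner h (g w)) \<le> a" if "w \<in> X" for w
    proof (rule onorm_bound)
      show "0 \<le> a"
        using assms(3)[OF that] norm_ge_zero order_trans by blast
      show "norm (inner h (g w)) \<le> a * norm h" for h
        using Cauchy_Schwarz_ineq2[of h "g w"] mult_left_mono[OF assms(3)[OF that], of "norm h"]
        by (simp add: mult.commute)
    qed
  qed (use assms in auto)
  then show ?thesis by simp
qed

section \<open>The base learners\<close>

text \<open>The three-point identity converts a variational inequality into squared distances that
  telescope. Projection and implicit update are both instances, differing only in where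
  \<open>g\<close> is evaluated.\<close>

lemma prox_inequality:
  fixes z y c g :: "'a::real_inner"
  assumes "0 \<le> inner (\<eta> *\<^sub>R g + (z - c)) (y - z)"
  shows "\<eta> * inner g (z - y) \<le> ((norm (y - c))\<^sup>2 - (norm (y - z))\<^sup>2 - (norm (z - c))\<^sup>2) / 2"
proof -
  have "(norm (y - c))\<^sup>2 - (norm (y - z))\<^sup>2 - (norm (z - c))\<^sup>2 = 2 * inner (z - c) (y - z)"
    unfolding power2_norm_eq_inner by (simp add: inner_commute algebra_simps)
  then show ?thesis
    using assms by (simp add: inner_add_left inner_diff_right algebra_simps)
qed

lemma projection_inequality:
  assumes "is_arg_min (\<lambda>y. norm (y - (c - \<eta> *\<^sub>R g))) (\<lambda>y. y \<in> X) z" "convex X" "y \<in> X"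
  shows "\<eta> * inner g (z - y) \<le> ((norm (y - c))\<^sup>2 - (norm (y - z))\<^sup>2 - (norm (z - c))\<^sup>2) / 2"
proof (rule prox_inequality)
  \<comment> \<open>Squaring keeps the minimiser and makes the objective differentiable at its
    centre too.\<close>
  have "is_arg_min (\<lambda>y. (norm (y - (c - \<eta> *\<^sub>R g)))\<^sup>2) (\<lambda>y. y \<in> X) z"
    using assms(1) unfolding is_arg_min_def
    by (metis norm_ge_zero power2_less_imp_less)
  from first_order_minimum[OF this assms(2) GDERIV_norm_diff_square assms(3)]
  show "0 \<le> inner (\<eta> *\<^sub>R g + (z - c)) (y - z)"
    by (simp add: inner_diff_left inner_add_left algebra_simps)
qed

lemma implicit_update_inequality:
  assumes "is_arg_min (\<lambda>y. f y + 1 / (2 * \<eta>) * (norm (y - c))\<^sup>2) (\<lambda>y. y \<in> X) z" "convex X" "y \<in> X"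
    and "GDERIV f z :> g" "\<eta> > 0"
  shows "\<eta> * inner g (z - y) \<le> ((norm (y - c))\<^sup>2 - (norm (y - z))\<^sup>2 - (norm (z - c))\<^sup>2) / 2"
proof (rule prox_inequality)
  have "GDERIV (\<lambda>y. f y + 1 / (2 * \<eta>) * (norm (y - c))\<^sup>2) z :>
      g + (1 / (2 * \<eta>)) *\<^sub>R (2 *\<^sub>R (z - c))"
    by (intro GDERIV_add assms GDERIV_cmult GDERIV_norm_diff_square)
  from first_order_minimum[OF assms(1,2) this assms(3)]
  have "0 \<le> inner (g + (1 / \<eta>) *\<^sub>R (z - c)) (y - z)"
    by simp
  then have "0 \<le> \<eta> * inner (g + (1 / \<eta>) *\<^sub>R (z - c)) (y - z)"
    using \<open>\<eta> > 0\<close> by simp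
  also have "\<dots> = inner (\<eta> *\<^sub>R (g + (1 / \<eta>) *\<^sub>R (z - c))) (y - z)"
    by simp
  finally show "0 \<le> inner (\<eta> *\<^sub>R g + (z - c)) (y - z)"
    using \<open>\<eta> > 0\<close> by (simp add: scaleR_right_distrib)
qed

text \<open>Write \<open>x - u\<close> as \<open>(x - xh') + (xh' - u)\<close> and \<open>g\<close>
  as \<open>(g - g') + g'\<close> on the first part. Adding the two hypotheses cancels the distance
  from \<open>xh'\<close> to \<open>xh\<close>; the leftover product of \<open>g - g'\<close> with
  \<open>x - xh'\<close> is paid for by the negative distance from \<open>xh'\<close> to
  \<open>x\<close>, via the square below.\<close>

lemma optimistic_step:
  fixes g g' x xh xh' u :: "'a::real_inner"
  assumes "\<eta> > 0"
    and "\<eta> * inner g (xh' - u) \<le> ((norm (u - xh))\<^sup>2 - (norm (u - xh'))\<^sup>2 - (norm (xh' - xh))\<^sup>2) / 2"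
    and "\<eta> * inner g' (x - xh') \<le> ((norm (xh' - xh))\<^sup>2 - (norm (xh' - x))\<^sup>2 - (norm (x - xh))\<^sup>2) / 2"
  shows "inner g (x - u) \<le> \<eta> / 2 * (norm (g - g'))\<^sup>2
           + ((norm (u - xh))\<^sup>2 - (norm (u - xh'))\<^sup>2) / (2 * \<eta>)"
proof -
  have "0 \<le> (norm (\<eta> *\<^sub>R (g - g') - (x - xh')))\<^sup>2"
    by simp
  also have "\<dots> = \<eta>\<^sup>2 * (norm (g - g'))\<^sup>2 - 2 * \<eta> * inner (g - g') (x - xh') + (norm (xh' - x))\<^sup>2"
    unfolding power2_norm_eq_inner
    by (simp add: inner_diff_left inner_diff_right inner_commute power2_eq_square algebra_simps)
  finally have "\<eta> * inner (g - g') (x - xh') \<le> (\<eta>\<^sup>2 * (norm (g - g'))\<^sup>2 + (norm (xh' - x))\<^sup>2) / 2"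
    by simp
  moreover have "\<eta> * inner g (x - u)
      = \<eta> * inner (g - g') (x - xh') + \<eta> * inner g' (x - xh') + \<eta> * inner g (xh' - u)"
    by (simp add: inner_diff_left inner_diff_right algebra_simps)
  moreover have "0 \<le> (norm (x - xh))\<^sup>2"
    by simp
  ultimately have "\<eta> * inner g (x - u)
      \<le> (\<eta>\<^sup>2 * (norm (g - g'))\<^sup>2 + (norm (u - xh))\<^sup>2 - (norm (u - xh'))\<^sup>2) / 2"
    using assms(2,3) by argo
  also have "\<dots> = \<eta> * (\<eta> / 2 * (norm (g - g'))\<^sup>2
      + ((norm (u - xh))\<^sup>2 - (norm (u - xh'))\<^sup>2) / (2 * \<eta>))"
    using \<open>\<eta> > 0\<close> by (simp add: field_simps power2_eq_square)
  finally show ?thesis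
    using \<open>\<eta> > 0\<close> by simp
qed

text \<open>Within a piece the distances telescope. Entering a new piece replaces one squared
  distance by another, costing at most \<open>D^2\<close>, and raises \<open>k\<close> by at least
  1.\<close>

lemma piecewise_constant_telescope:
  fixes u xh :: "nat \<Rightarrow> 'a::real_normed_vector"
  assumes "\<And>s t. \<lbrakk>s \<in> {1..T}; t \<in> {1..T + 1}\<rbrakk> \<Longrightarrow> norm (u s - xh t) \<le> D" and "1 \<le> T"
    and u: "\<And>t. t \<in> {1..T} \<Longrightarrow> u t = v (k t)" and k: "k 1 = 0" "mono k"
  shows "(\<Sum>t=1..T. (norm (u t - xh t))\<^sup>2 - (norm (u t - xh (t + 1)))\<^sup>2) \<le> D\<^sup>2 * real (k T + 1)"
proof -
  have sq: "(norm (u s - xh t))\<^sup>2 \<le> D\<^sup>2" if "s \<in> {1..T}" "t \<in> {1..T + 1}" for s t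
    using assms(1)[OF that] by (intro power_mono) auto
  \<comment> \<open>The last distance stays on the left: it is what the next round subtracts when
    the piece does not change.\<close>
  have "(\<Sum>t=1..n. (norm (u t - xh t))\<^sup>2 - (norm (u t - xh (t + 1)))\<^sup>2)
      + (norm (u n - xh (n + 1)))\<^sup>2 \<le> D\<^sup>2 * real (k n + 1)" if "1 \<le> n" "n \<le> T" for n
    using that
  proof (induction n rule: dec_induct)
    case base
    then show ?case
      using sq[of 1 1] k by simp
  next
    case (step n)
    have "(norm (u (Suc n) - xh (Suc n)))\<^sup>2 - (norm (u n - xh (Suc n)))\<^sup>2
        \<le> D\<^sup>2 * (real (k (Suc n)) - real (k n))"
    proof (cases "k (Suc n) = k n")
      case True
      then show ?thesis
        using u[of n] u[of "Suc n"] step by simp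
    next
      case False
      then have "k n + 1 \<le> k (Suc n)"
        using \<open>mono k\<close> by (metis Suc_eq_plus1 Suc_leI le_SucI le_refl monoD nat_less_le)
      then have "D\<^sup>2 * 1 \<le> D\<^sup>2 * (real (k (Suc n)) - real (k n))"
        by (intro mult_left_mono) auto
      then show ?thesis
        using sq[of "Suc n" "Suc n"] step by (smt (verit) atLeastAtMost_iff zero_le_power2
            le_SucI Suc_eq_plus1 mult.right_neutral le_add2)
    qed
    then show ?case
      using step by (simp add: algebra_simps)
  qed
  from this[of T] show ?thesis
    using \<open>1 \<le> T\<close> zero_le_power2[of "norm (u T - xh (T + 1))"] by linarith
qed

section \<open>Optimistic hedge with decreasing learning rates\<close>

text \<open>The free energy used as potential of hedge. Dividing by \<open>card I\<close> makes it a
  power mean, hence decreasing in the rate; the unnormalised version is increasing, and lowering the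
  rate would then cost something in every round.\<close>

definition soft_min :: "'i set \<Rightarrow> real \<Rightarrow> ('i \<Rightarrow> real) \<Rightarrow> real" where
  "soft_min I \<epsilon> L = - ln ((\<Sum>i\<in>I. exp (- \<epsilon> * L i)) / card I) / \<epsilon>"

lemma soft_min_zero: "finite I \<Longrightarrow> I \<noteq> {} \<Longrightarrow> soft_min I \<epsilon> (\<lambda>_. 0) = 0"
  by (simp add: soft_min_def)

lemma soft_min_le:
  assumes "finite I" "i \<in> I" "\<epsilon> > 0"
  shows "soft_min I \<epsilon> L \<le> L i + ln (card I) / \<epsilon>"
proof -
  have c: "card I > 0"
    using assms card_gt_0_iff by blast
  have "exp (- \<epsilon> * L i) \<le> (\<Sum>i\<in>I. exp (- \<epsilon> * L i))"
    using assms by (intro member_le_sum) auto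
  then have "ln (exp (- \<epsilon> * L i) / card I) \<le> ln ((\<Sum>i\<in>I. exp (- \<epsilon> * L i)) / card I)"
    using c by (subst ln_le_cancel_iff)
      (auto intro!: divide_right_mono divide_pos_pos intro: less_le_trans[OF exp_gt_zero])
  then have "- ln ((\<Sum>i\<in>I. exp (- \<epsilon> * L i)) / card I) \<le> \<epsilon> * L i + ln (card I)"
    using c by (simp add: ln_div)
  then show ?thesis
    using \<open>\<epsilon> > 0\<close> by (simp add: soft_min_def field_simps)
qed

text \<open>Concavity of \<open>y \<mapsto> y powr (\<epsilon>' / \<epsilon>)\<close>, in the form of Young's inequality against the mean.\<close>

lemma soft_min_antimono:
  assumes "finite I" "I \<noteq> {}" "0 < \<epsilon>'" "\<epsilon>' \<le> \<epsilon>"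
  shows "soft_min I \<epsilon> L \<le> soft_min I \<epsilon>' L"
proof -
  define c where "c = \<epsilon>' / \<epsilon>"
  have c: "0 < c" "c \<le> 1" "\<epsilon> > 0"
    using assms by (auto simp: c_def)
  define A where "A = (\<Sum>i\<in>I. exp (- \<epsilon> * L i)) / card I"
  have n: "real (card I) > 0"
    using assms by (simp add: card_gt_0_iff)
  have A: "A > 0"
    using assms n unfolding A_def by (intro divide_pos_pos sum_pos) auto
  have pt: "exp (- \<epsilon>' * L i) \<le> A powr c * (1 + c * (exp (- \<epsilon> * L i) / A - 1))" for i
  proof -
    define y where "y = exp (- \<epsilon> * L i) / A"
    have y: "y > 0"
      using A by (simp add: y_def)
    have "y powr c * 1 powr (1 - c) \<le> c * y + (1 - c) * 1"
      using Youngs_inequality_0[of c "1 - c" y 1] c y by simp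
    then have "y powr c \<le> 1 + c * (y - 1)"
      by (simp add: algebra_simps)
    then have "A powr c * y powr c \<le> A powr c * (1 + c * (y - 1))"
      by (intro mult_left_mono) auto
    moreover have "A powr c * y powr c = exp (- \<epsilon> * L i) powr c"
      using A y by (simp add: y_def flip: powr_mult)
    moreover have "exp (- \<epsilon> * L i) powr c = exp (- \<epsilon>' * L i)"
      using c by (simp add: powr_def c_def)
    ultimately show ?thesis
      by (simp add: y_def)
  qed
  have "(\<Sum>i\<in>I. exp (- \<epsilon>' * L i)) \<le> (\<Sum>i\<in>I. A powr c * (1 + c * (exp (- \<epsilon> * L i) / A - 1)))"
    by (intro sum_mono pt)
  also have "\<dots> = A powr c * (card I + c * ((\<Sum>i\<in>I. exp (- \<epsilon> * L i)) / A - card I))"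
    by (simp add: sum.distrib sum_subtractf flip: sum_distrib_left sum_divide_distrib)
  also have "(\<Sum>i\<in>I. exp (- \<epsilon> * L i)) / A = card I"
    using A n unfolding A_def by (simp add: zero_less_divide_iff)
  finally have "(\<Sum>i\<in>I. exp (- \<epsilon>' * L i)) / card I \<le> A powr c"
    using n by (simp add: field_simps)
  moreover have "(\<Sum>i\<in>I. exp (- \<epsilon>' * L i)) / card I > 0"
    using assms n by (intro divide_pos_pos sum_pos) auto
  ultimately have "ln ((\<Sum>i\<in>I. exp (- \<epsilon>' * L i)) / card I) \<le> c * ln A"
    using A by (metis ln_powr ln_le_cancel_iff less_le_trans)
  then have "- (c * ln A) / \<epsilon>' \<le> soft_min I \<epsilon>' L"
    using \<open>0 < \<epsilon>'\<close> unfolding soft_min_def by (intro divide_right_mono) auto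
  moreover have "- (c * ln A) / \<epsilon>' = soft_min I \<epsilon> L"
    using assms by (simp add: soft_min_def A_def c_def)
  ultimately show ?thesis
    by simp
qed

lemma exp_minus_le_quadratic:
  fixes y :: real
  assumes "\<bar>y\<bar> \<le> 1"
  shows "exp (- y) \<le> 1 - y + y\<^sup>2"
proof (cases "y \<ge> 0")
  case True
  have "1 + y ^ 3 \<ge> 1"
    using True by simp
  moreover have "(1 - y + y\<^sup>2) * (1 + y) = 1 + y ^ 3"
    by (simp add: algebra_simps power2_eq_square power3_eq_cube)
  ultimately have "1 / (1 + y) \<le> 1 - y + y\<^sup>2"
    using True by (simp add: field_simps)
  moreover have "exp (- y) \<le> 1 / (1 + y)"
    using True exp_ge_add_one_self[of y] by (simp add: exp_minus field_simps)
  ultimately show ?thesis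
    by linarith
next
  case False
  then show ?thesis
    using exp_bound[of "- y"] assms by simp
qed

text \<open>No upper bound on \<epsilon> is available, since the rate of a round is fixed before the
  error \<open>v\<close> of that round is known. If \<open>\<epsilon> * v\<close> exceeds 1, the
  crude range bound suffices: the exponents differ by at most \<open>2 * \<epsilon> * v\<close>,
  which twice its square dominates. This case forces the factor 2.\<close>

lemma exp_moment_bound:
  fixes p X :: "'i \<Rightarrow> real"
  assumes "finite I" "\<And>i. i \<in> I \<Longrightarrow> p i \<ge> 0" "(\<Sum>i\<in>I. p i) = 1"
    and v: "\<And>i. i \<in> I \<Longrightarrow> \<bar>X i\<bar> \<le> v" and "\<epsilon> > 0"
  shows "(\<Sum>i\<in>I. p i * exp (- \<epsilon> * X i)) \<le> exp (- \<epsilon> * (\<Sum>i\<in>I. p i * X i) + 2 * \<epsilon>\<^sup>2 * v\<^sup>2)"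
proof (cases "\<epsilon> * v \<le> 1")
  case True
  have "(\<Sum>i\<in>I. p i * exp (- \<epsilon> * X i)) \<le> (\<Sum>i\<in>I. p i * (1 - \<epsilon> * X i + \<epsilon>\<^sup>2 * v\<^sup>2))"
  proof (intro sum_mono mult_left_mono assms)
    fix i assume "i \<in> I"
    have le: "\<bar>\<epsilon> * X i\<bar> \<le> \<epsilon> * v"
      using v[OF \<open>i \<in> I\<close>] \<open>\<epsilon> > 0\<close> by (simp add: abs_mult)
    then have "exp (- (\<epsilon> * X i)) \<le> 1 - \<epsilon> * X i + (\<epsilon> * X i)\<^sup>2"
      using True by (intro exp_minus_le_quadratic) linarith
    moreover have "(\<epsilon> * X i)\<^sup>2 \<le> (\<epsilon> * v)\<^sup>2"
      using le by (simp add: abs_le_square_iff[symmetric])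
    ultimately show "exp (- \<epsilon> * X i) \<le> 1 - \<epsilon> * X i + \<epsilon>\<^sup>2 * v\<^sup>2"
      by (simp add: power_mult_distrib)
  qed
  also have "\<dots> = (\<Sum>i\<in>I. p i) * (1 + \<epsilon>\<^sup>2 * v\<^sup>2) - \<epsilon> * (\<Sum>i\<in>I. p i * X i)"
    unfolding sum_distrib_left sum_distrib_right sum_subtractf[symmetric]
    by (intro sum.cong) (auto simp: algebra_simps)
  also have "\<dots> \<le> 1 + (- \<epsilon> * (\<Sum>i\<in>I. p i * X i) + 2 * \<epsilon>\<^sup>2 * v\<^sup>2)"
    using assms by simp
  also have "\<dots> \<le> exp (- \<epsilon> * (\<Sum>i\<in>I. p i * X i) + 2 * \<epsilon>\<^sup>2 * v\<^sup>2)"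
    by (rule exp_ge_add_one_self)
  finally show ?thesis .
next
  case False
  have "(\<Sum>i\<in>I. p i * exp (- \<epsilon> * X i)) \<le> (\<Sum>i\<in>I. p i * exp (\<epsilon> * v))"
  proof (intro sum_mono mult_left_mono assms)
    fix i assume "i \<in> I"
    then have "- X i \<le> v"
      using v by (simp add: abs_le_iff)
    then have "\<epsilon> * (- X i) \<le> \<epsilon> * v"
      using \<open>\<epsilon> > 0\<close> by (intro mult_left_mono) auto
    then show "exp (- \<epsilon> * X i) \<le> exp (\<epsilon> * v)"
      by simp
  qed
  also have "\<dots> = exp (\<epsilon> * v)"
    using assms by (simp flip: sum_distrib_right)
  also have "\<dots> \<le> exp (- \<epsilon> * (\<Sum>i\<in>I. p i * X i) + 2 * \<epsilon>\<^sup>2 * v\<^sup>2)"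
  proof -
    have "(\<Sum>i\<in>I. p i * X i) \<le> (\<Sum>i\<in>I. p i * v)"
      using v by (intro sum_mono mult_left_mono assms) (auto simp: abs_le_iff)
    then have "(\<Sum>i\<in>I. p i * X i) \<le> v"
      using assms by (simp flip: sum_distrib_right)
    then have "\<epsilon> * (\<Sum>i\<in>I. p i * X i) \<le> \<epsilon> * v"
      using \<open>\<epsilon> > 0\<close> by simp
    moreover have "\<epsilon> * v \<le> (\<epsilon> * v)\<^sup>2"
      using False self_le_power[of "\<epsilon> * v" 2] by simp
    ultimately show ?thesis
      by (simp add: power_mult_distrib)
  qed
  finally show ?thesis .
qed

text \<open>The weights already contain the hint \<open>m\<close>, so the partition sum
  \<open>Q Lm\<close> lies between those of \<open>L\<close> and \<open>L + loss\<close>. The moment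
  bound controls the passage from \<open>Lm\<close> to \<open>L + loss\<close>, at the price of the
  hint error, and Jensen's inequality the passage from \<open>L\<close> to \<open>Lm\<close>;
  \<open>Q Lm\<close> cancels.\<close>

lemma soft_min_step:
  fixes L m loss :: "'i \<Rightarrow> real"
  assumes "finite I" "I \<noteq> {}" "\<epsilon> > 0"
    and p: "\<And>i. i \<in> I \<Longrightarrow>
      p i = exp (- \<epsilon> * (L i + m i)) / (\<Sum>j\<in>I. exp (- \<epsilon> * (L j + m j)))"
    and v: "\<And>i. i \<in> I \<Longrightarrow> \<bar>loss i - m i\<bar> \<le> v"
  shows "(\<Sum>i\<in>I. p i * loss i) \<le>
    soft_min I \<epsilon> (\<lambda>i. L i + loss i) - soft_min I \<epsilon> L + 2 * \<epsilon> * v\<^sup>2"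
proof -
  define Q where "Q L' = (\<Sum>i\<in>I. exp (- \<epsilon> * L' i))" for L' :: "'i \<Rightarrow> real"
  have Q: "Q L' > 0" for L'
    unfolding Q_def using assms by (intro sum_pos) auto
  define Lm where "Lm i = L i + m i" for i
  have p': "p i = exp (- \<epsilon> * Lm i) / Q Lm" if "i \<in> I" for i
    using p[OF that] by (simp add: Q_def Lm_def)
  have p0: "p i \<ge> 0" if "i \<in> I" for i
    using p'[OF that] Q[of Lm] by simp
  have p1: "(\<Sum>i\<in>I. p i) = 1"
    using Q[of Lm] by (simp add: p' flip: sum_divide_distrib) (simp add: Q_def)
  have "Q (\<lambda>i. L i + loss i) / Q Lm = (\<Sum>i\<in>I. p i * exp (- \<epsilon> * (loss i - m i)))"
    unfolding Q_def[of "\<lambda>i. L i + loss i"] sum_divide_distrib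
  proof (rule sum.cong)
    fix i assume "i \<in> I"
    have "exp (- \<epsilon> * (L i + loss i)) = exp (- \<epsilon> * Lm i) * exp (- \<epsilon> * (loss i - m i))"
      by (simp add: mult_exp_exp Lm_def) (simp add: algebra_simps)
    then show "exp (- \<epsilon> * (L i + loss i)) / Q Lm = p i * exp (- \<epsilon> * (loss i - m i))"
      using \<open>i \<in> I\<close> by (simp add: p')
  qed simp
  also have "\<dots> \<le> exp (- \<epsilon> * (\<Sum>i\<in>I. p i * (loss i - m i)) + 2 * \<epsilon>\<^sup>2 * v\<^sup>2)"
    using assms p0 p1 by (intro exp_moment_bound) auto
  finally have "ln (Q (\<lambda>i. L i + loss i) / Q Lm)
      \<le> ln (exp (- \<epsilon> * (\<Sum>i\<in>I. p i * (loss i - m i)) + 2 * \<epsilon>\<^sup>2 * v\<^sup>2))"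
    using Q by (subst ln_le_cancel_iff) auto
  then have 1: "ln (Q (\<lambda>i. L i + loss i)) - ln (Q Lm)
      \<le> - \<epsilon> * (\<Sum>i\<in>I. p i * (loss i - m i)) + 2 * \<epsilon>\<^sup>2 * v\<^sup>2"
    using Q[of Lm] Q[of "\<lambda>i. L i + loss i"] by (simp add: ln_div)
  \<comment> \<open>Jensen for \<open>exp\<close>: undoing the hint under the weights
    \<open>p\<close> costs no second-order term.\<close>
  have "exp (\<Sum>i\<in>I. p i *\<^sub>R (\<epsilon> * m i)) \<le> (\<Sum>i\<in>I. p i * exp (\<epsilon> * m i))"
    using assms p0 p1 by (intro convex_on_sum[OF _ _ exp_convex]) auto
  also have "\<dots> = Q L / Q Lm"
    unfolding Q_def[of L] sum_divide_distrib
  proof (rule sum.cong)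
    fix i assume "i \<in> I"
    have "exp (- \<epsilon> * L i) = exp (- \<epsilon> * Lm i) * exp (\<epsilon> * m i)"
      by (simp add: mult_exp_exp Lm_def) (simp add: algebra_simps)
    then show "p i * exp (\<epsilon> * m i) = exp (- \<epsilon> * L i) / Q Lm"
      using \<open>i \<in> I\<close> by (simp add: p')
  qed simp
  finally have "(\<Sum>i\<in>I. p i *\<^sub>R (\<epsilon> * m i)) \<le> ln (Q L / Q Lm)"
    using Q by (subst ln_ge_iff) auto
  then have 2: "\<epsilon> * (\<Sum>i\<in>I. p i * m i) \<le> ln (Q L) - ln (Q Lm)"
    using Q[of L] Q[of Lm] by (simp add: ln_div sum_distrib_left mult.left_commute)
  have s: "soft_min I \<epsilon> L' = (ln (card I) - ln (Q L')) / \<epsilon>" for L'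
    unfolding soft_min_def Q_def[symmetric]
    using Q[of L'] assms by (simp add: ln_div card_gt_0_iff flip: minus_divide_left)
  have "\<epsilon> * (\<Sum>i\<in>I. p i * loss i) = \<epsilon> * (\<Sum>i\<in>I. p i * m i) + \<epsilon> * (\<Sum>i\<in>I. p i * (loss i - m i))"
    by (simp add: algebra_simps sum_subtractf)
  also have "\<dots> \<le> ln (Q L) - ln (Q (\<lambda>i. L i + loss i)) + 2 * \<epsilon>\<^sup>2 * v\<^sup>2"
    using 1 2 by simp
  also have "\<dots> = \<epsilon> * (soft_min I \<epsilon> (\<lambda>i. L i + loss i) - soft_min I \<epsilon> L + 2 * \<epsilon> * v\<^sup>2)"
    using \<open>\<epsilon> > 0\<close> by (simp add: s field_simps power2_eq_square)
  finally show ?thesis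
    using \<open>\<epsilon> > 0\<close> by simp
qed

text \<open>Potentials telescope because switching to the next, smaller rate only increases
  \<open>soft_min\<close>. The weights of round \<open>Suc t\<close> use the rate of index
  \<open>t\<close>, hence \<open>\<epsilon> (t - 1)\<close> in the last sum.\<close>

lemma optimistic_hedge_regret:
  fixes loss m p :: "nat \<Rightarrow> 'i \<Rightarrow> real"
  assumes "finite I" "\<And>t. \<epsilon> t > 0" "antimono \<epsilon>"
    and p: "\<And>t i. \<lbrakk>t < T; i \<in> I\<rbrakk> \<Longrightarrow> p (Suc t) i =
      exp (- \<epsilon> t * ((\<Sum>s=1..t. loss s i) + m (Suc t) i)) /
      (\<Sum>j\<in>I. exp (- \<epsilon> t * ((\<Sum>s=1..t. loss s j) + m (Suc t) j)))"
    and v: "\<And>t i. \<lbrakk>t \<in> {1..T}; i \<in> I\<rbrakk> \<Longrightarrow> \<bar>loss t i - m t i\<bar> \<le> v t"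
    and i: "i \<in> I"
  shows "(\<Sum>t=1..T. \<Sum>j\<in>I. p t j * loss t j) \<le>
    (\<Sum>t=1..T. loss t i) + ln (card I) / \<epsilon> T + 2 * (\<Sum>t=1..T. \<epsilon> (t - 1) * (v t)\<^sup>2)"
proof -
  have I: "I \<noteq> {}"
    using i by blast
  have "(\<Sum>t=1..n. \<Sum>j\<in>I. p t j * loss t j) \<le>
      soft_min I (\<epsilon> n) (\<lambda>i. \<Sum>t=1..n. loss t i) + 2 * (\<Sum>t=1..n. \<epsilon> (t - 1) * (v t)\<^sup>2)"
    if "n \<le> T" for n
    using that
  proof (induction n)
    case 0
    then show ?case
      using soft_min_zero[OF \<open>finite I\<close> I] by simp
  next
    case (Suc n)
    have "(\<Sum>j\<in>I. p (Suc n) j * loss (Suc n) j) \<le>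
        soft_min I (\<epsilon> n) (\<lambda>i. (\<Sum>t=1..n. loss t i) + loss (Suc n) i)
        - soft_min I (\<epsilon> n) (\<lambda>i. \<Sum>t=1..n. loss t i) + 2 * \<epsilon> n * (v (Suc n))\<^sup>2"
      using Suc.prems by (intro soft_min_step[where m = "m (Suc n)"] \<open>finite I\<close> I p v assms) auto
    moreover have "soft_min I (\<epsilon> n) (\<lambda>i. (\<Sum>t=1..n. loss t i) + loss (Suc n) i)
        \<le> soft_min I (\<epsilon> (Suc n)) (\<lambda>i. (\<Sum>t=1..n. loss t i) + loss (Suc n) i)"
      using assms I by (intro soft_min_antimono) (auto simp: antimono_def)
    ultimately show ?case
      using Suc by (simp add: algebra_simps)
  qed
  from this[of T] show ?thesis
    using soft_min_le[OF \<open>finite I\<close> i assms(2), of T "\<lambda>i. \<Sum>t=1..T. loss t i"] by simp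
qed

lemma sum_inverse_sqrt_le:
  fixes a :: "nat \<Rightarrow> real"
  assumes "\<And>t. a t \<ge> 0"
  shows "(\<Sum>t=1..n. a t / sqrt (1 + (\<Sum>s=1..t. a s))) \<le> 2 * sqrt (1 + (\<Sum>s=1..n. a s)) - 2"
proof (induction n)
  case (Suc n)
  define b where "b = 1 + (\<Sum>s=1..n. a s)"
  define c where "c = b + a (Suc n)"
  have b: "b \<ge> 1"
    using assms by (simp add: b_def sum_nonneg)
  have c: "c \<ge> b"
    using assms by (simp add: c_def)
  have "a (Suc n) / sqrt c \<le> 2 * (sqrt c - sqrt b)"
  proof -
    have "c - b = (sqrt c - sqrt b) * (sqrt c + sqrt b)"
      using b c by (simp add: algebra_simps)
    also have "\<dots> \<le> (sqrt c - sqrt b) * (2 * sqrt c)"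
      using b c by (intro mult_left_mono) auto
    finally show ?thesis
      using b c by (simp add: field_simps c_def)
  qed
  then show ?case
    using Suc by (simp add: b_def c_def add.assoc)
qed simp

text \<open>
  The rate of round \<open>t\<close> lags one round behind; replacing it by the current one costs a telescoping
  sum.
\<close>

lemma sum_lagged_rate_le:
  fixes v :: "nat \<Rightarrow> real"
  defines "\<epsilon> \<equiv> \<lambda>t. 1 / sqrt (1 + (\<Sum>s=1..t. (v s)\<^sup>2))"
  assumes b: "\<And>t. t \<in> {1..T} \<Longrightarrow> (v t)\<^sup>2 \<le> b" and "b \<ge> 0"
  shows "(\<Sum>t=1..T. \<epsilon> (t - 1) * (v t)\<^sup>2) \<le> 2 * sqrt (1 + (\<Sum>t=1..T. (v t)\<^sup>2)) + b"
proof -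
  have anti: "\<epsilon> t \<le> \<epsilon> (t - 1)" for t
    unfolding \<epsilon>_def
    by (intro divide_left_mono mult_pos_pos real_sqrt_gt_zero real_sqrt_le_mono add_left_mono
        sum_mono2 add_pos_nonneg sum_nonneg) auto
  have "(\<Sum>t=1..T. \<epsilon> (t - 1) * (v t)\<^sup>2) \<le> (\<Sum>t=1..T. \<epsilon> t * (v t)\<^sup>2 + (\<epsilon> (t - 1) - \<epsilon> t) * b)"
  proof (intro sum_mono)
    fix t assume "t \<in> {1..T}"
    then have "(\<epsilon> (t - 1) - \<epsilon> t) * (v t)\<^sup>2 \<le> (\<epsilon> (t - 1) - \<epsilon> t) * b"
      using b anti[of t] by (intro mult_left_mono) auto
    then show "\<epsilon> (t - 1) * (v t)\<^sup>2 \<le> \<epsilon> t * (v t)\<^sup>2 + (\<epsilon> (t - 1) - \<epsilon> t) * b"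
      by (simp add: algebra_simps)
  qed
  also have "\<dots> = (\<Sum>t=1..T. (v t)\<^sup>2 / sqrt (1 + (\<Sum>s=1..t. (v s)\<^sup>2)))
      + (\<Sum>t=1..T. \<epsilon> (t - 1) - \<epsilon> t) * b"
    by (simp add: sum.distrib sum_distrib_right \<epsilon>_def)
  also have "(\<Sum>t=1..T. \<epsilon> (t - 1) - \<epsilon> t) = \<epsilon> 0 - \<epsilon> T"
    by (induction T) auto
  also have "(\<epsilon> 0 - \<epsilon> T) * b \<le> 1 * b"
  proof (rule mult_right_mono)
    have "\<epsilon> T \<ge> 0"
      by (simp add: \<epsilon>_def sum_nonneg)
    then show "\<epsilon> 0 - \<epsilon> T \<le> 1"
      by (simp add: \<epsilon>_def)
  qed fact
  finally show ?thesis
    using sum_inverse_sqrt_le[of "\<lambda>t. (v t)\<^sup>2" T] by simp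
qed

section \<open>Dynamic regret of the two-layer algorithm\<close>

text \<open>The left side is minimised at \<open>e = D * sqrt n / sqrt (1 + W)\<close>, which is
  \<open>r\<close> times the smallest step of the grid. As \<open>1 + W\<close> is at most
  \<open>A\<close> and \<open>n\<close> at most \<open>T\<close>, \<open>r\<close> lies between 1
  and \<open>2 ^ (N - 1)\<close>, so some grid step is at most \<open>e\<close> and at least
  \<open>e / 2\<close>. Being too small does not hurt the first term and at most doubles the second:
  1/2 + 1 = 3/2.\<close>

lemma num_experts_grid:
  assumes "D > 0" "1 \<le> n" "n \<le> T" "0 \<le> W" "W \<le> 4 * real T * G\<^sup>2"
  shows "\<exists>i\<in>{1..num_experts T G}.
    step_size T G D i / 2 * (1 + W) + D\<^sup>2 * real n / (2 * step_size T G D i)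
      \<le> 3 / 2 * D * sqrt (real n * (1 + W))"
proof -
  define A where "A = 1 + 4 * real T * G\<^sup>2"
  have A: "A \<ge> 1" "1 + W \<le> A"
    using assms by (auto simp: A_def)
  define r where "r = sqrt (real n * A / (1 + W))"
  have "1 * (1 + W) \<le> real n * A"
    using A assms by (intro mult_mono) auto
  then have r1: "r \<ge> 1"
    using assms by (simp add: r_def)
  define N where "N = num_experts T G"
  have rN: "r \<le> 2 ^ (N - 1)"
  proof -
    define y where "y = (1 + 2 * real T) * A"
    have "real n * A \<le> y"
      using assms A unfolding y_def by (intro mult_right_mono) auto
    moreover have "real n * A / (1 + W) \<le> real n * A / 1"
      using assms A by (intro divide_left_mono) auto
    ultimately have "r \<le> sqrt y"
      by (simp add: r_def)
    moreover have "y \<ge> 1"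
      using \<open>real n * A \<le> y\<close> A assms mult_mono[of 1 "real n" 1 A] by simp
    then have "(2 powr log 2 y) powr (1 / 2) = sqrt y"
      by (simp add: powr_half_sqrt)
    then have "sqrt y = 2 powr (1 / 2 * log 2 y)"
      by (simp add: powr_powr)
    moreover have "1 / 2 * log 2 y \<le> real (N - 1)"
      unfolding N_def num_experts_def y_def A_def by (simp add: of_nat_ceiling)
    ultimately have "r \<le> 2 powr real (N - 1)"
      by (smt (verit) powr_mono)
    then show ?thesis
      by (simp add: powr_realpow)
  qed
  \<comment> \<open>Rounding down in the exponent; \<open>step_size\<close> has exponent
    \<open>i - 1\<close>, so the expert is \<open>j + 1\<close>.\<close>
  define j where "j = nat \<lfloor>log 2 r\<rfloor>"
  have "0 \<le> log 2 r"
    using r1 by simp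
  then have j: "real j \<le> log 2 r" "log 2 r < real j + 1"
    unfolding j_def by linarith+
  have j1: "2 ^ j \<le> r" and j2: "r \<le> 2 * 2 ^ j"
  proof -
    have "2 powr real j \<le> 2 powr log 2 r" "2 powr log 2 r \<le> 2 powr (real j + 1)"
      using j by (intro powr_mono; simp)+
    then show "2 ^ j \<le> r" "r \<le> 2 * 2 ^ j"
      using r1 by (auto simp: powr_realpow powr_add)
  qed
  have "2 ^ j \<le> (2::real) ^ (N - 1)"
    using j1 rN by linarith
  then have "j \<le> N - 1"
    by (subst (asm) power_increasing_iff) auto
  moreover have "N \<ge> 1"
    by (simp add: N_def num_experts_def)
  ultimately have i: "j + 1 \<in> {1..N}"
    by auto
  define \<eta> where "\<eta> = step_size T G D (j + 1)"
  have eta: "\<eta> = D / sqrt A * 2 ^ j"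
    by (simp add: \<eta>_def step_size_def A_def)
  have sA: "sqrt A > 0"
    using A by simp
  have \<eta>0: "\<eta> > 0"
    using assms sA by (simp add: eta)
  define e where "e = D / sqrt A * r"
  have e: "\<eta> \<le> e" "e \<le> 2 * \<eta>"
    unfolding eta e_def using j1 j2 assms sA by (auto intro!: divide_right_mono mult_left_mono)
  have e': "e = D * sqrt (real n) / sqrt (1 + W)"
    using sA by (simp add: e_def r_def real_sqrt_mult real_sqrt_divide)
  have s: "sqrt (1 + W) > 0" "sqrt (real n) > 0"
    using assms by auto
  have "\<eta> / 2 * (1 + W) \<le> e / 2 * (1 + W)"
    using e assms by (intro mult_right_mono) auto
  also have "\<dots> = D * sqrt (real n) * sqrt (1 + W) / 2"
    using s assms unfolding e' by (simp add: field_simps flip: power2_eq_square)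
  finally have 1: "\<eta> / 2 * (1 + W) \<le> D * sqrt (real n) * sqrt (1 + W) / 2" .
  have "D\<^sup>2 * real n / (2 * \<eta>) \<le> D\<^sup>2 * real n / e"
    using e \<eta>0 by (intro divide_left_mono) auto
  also have "\<dots> = D * sqrt (real n) * sqrt (1 + W)"
  proof -
    have "D\<^sup>2 * real n = e * (D * sqrt (real n) * sqrt (1 + W))"
      using s assms unfolding e' by (simp add: power2_eq_square)
    then show ?thesis
      using e \<eta>0 by simp
  qed
  finally have "\<eta> / 2 * (1 + W) + D\<^sup>2 * real n / (2 * \<eta>) \<le> 3 / 2 * D * sqrt (real n * (1 + W))"
    using 1 by (simp add: real_sqrt_mult)
  then show ?thesis
    using i unfolding \<eta>_def N_def by blast
qed

text \<open>A run on one fixed sequence of losses, without probability; it is instantiated once for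
  every outcome.\<close>

locale two_layer =
  fixes X :: "'a::euclidean_space set" and D G :: real and T :: nat and xref :: 'a
    and f :: "nat \<Rightarrow> 'a \<Rightarrow> real" and x xh :: "nat \<Rightarrow> nat \<Rightarrow> 'a" and p :: "nat \<Rightarrow> nat \<Rightarrow> real"
  assumes convex_X: "convex X"
    and diam: "\<And>y z. y \<in> X \<Longrightarrow> z \<in> X \<Longrightarrow> norm (y - z) \<le> D"
    and f_convex: "\<And>t. t \<in> {1..T} \<Longrightarrow> convex_on X (f t)"
    and f_grad: "\<And>t. t \<in> {1..T} \<Longrightarrow> gradient_bounded_on X G (f t)"
    and xref: "xref \<in> X"
    and run: "two_layer_run X D G T xref f x xh p"
begin

abbreviation "N \<equiv> num_experts T G"
abbreviation "\<eta> \<equiv> step_size T G D"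

lemma N_pos: "N \<ge> 1"
  by (simp add: num_experts_def)

lemma gderiv:
  assumes "t \<in> {1..T}" "y \<in> X"
  shows "GDERIV (f t) y :> gradient (f t) y" and "norm (gradient (f t) y) \<le> G"
  using f_grad[OF assms(1)] assms(2) by (auto simp: gradient_bounded_on_def intro: GDERIV_gradient)

lemma run_init:
  assumes "i \<in> {1..N}"
  shows "x 1 i \<in> X" "xh 1 i = x 1 i" "p 1 i = 1 / real N"
  using run assms unfolding two_layer_run_def Let_def by blast+

lemma run_step:
  assumes "t \<in> {1..T}" "i \<in> {1..N}"
  shows "is_arg_min (\<lambda>y. norm (y - (xh t i - \<eta> i *\<^sub>R gradient (f t) (x t i))))
           (\<lambda>y. y \<in> X) (xh (t + 1) i)"
    and "is_arg_min (\<lambda>y. f t y + 1 / (2 * \<eta> i) * (norm (y - xh (t + 1) i))\<^sup>2)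
           (\<lambda>y. y \<in> X) (x (t + 1) i)"
    and "p (t + 1) i =
      exp (- meta_rate N f xref x t * ((\<Sum>s=1..t. f s (x s i)) + f t (x (t + 1) i))) /
      (\<Sum>j=1..N. exp (- meta_rate N f xref x t * ((\<Sum>s=1..t. f s (x s j)) + f t (x (t + 1) j))))"
  using run assms unfolding two_layer_run_def Let_def by blast+

lemma iterates_in:
  assumes "t \<in> {1..T + 1}" "i \<in> {1..N}"
  shows "x t i \<in> X" "xh t i \<in> X"
proof -
  have "x t i \<in> X \<and> xh t i \<in> X"
  proof (cases "t = 1")
    case True
    then show ?thesis
      using run_init[OF assms(2)] by simp
  next
    case False
    then have "t - 1 \<in> {1..T}" "t - 1 + 1 = t"
      using assms by auto
    then show ?thesis
      using run_step(1,2)[OF _ assms(2), of "t - 1"] by (simp add: is_arg_min_def)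
  qed
  then show "x t i \<in> X" "xh t i \<in> X"
    by auto
qed

text \<open>Passing from \<open>f s\<close> to \<open>ref_loss f xref s\<close> multiplies all weights by a common factor.\<close>

lemma weights:
  assumes "t < T" "i \<in> {1..N}"
  shows "p (Suc t) i =
    exp (- meta_rate N f xref x t *
      ((\<Sum>s=1..t. ref_loss f xref s (x s i)) + ref_loss f xref t (x (Suc t) i))) /
    (\<Sum>j\<in>{1..N}. exp (- meta_rate N f xref x t *
      ((\<Sum>s=1..t. ref_loss f xref s (x s j)) + ref_loss f xref t (x (Suc t) j))))"
proof (cases "t = 0")
  case True
  then show ?thesis
    using run_init[OF assms(2)] by (simp add: ref_loss_def)
next
  case False
  define \<epsilon> where "\<epsilon> = meta_rate N f xref x t"
  define c where "c = (\<Sum>s=1..t. f s xref) + f t xref"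
  have *: "exp (- \<epsilon> * ((\<Sum>s=1..t. ref_loss f xref s (x s j)) + ref_loss f xref t (x (Suc t) j)))
    = exp (- \<epsilon> * ((\<Sum>s=1..t. f s (x s j)) + f t (x (Suc t) j))) * exp (\<epsilon> * c)" for j
  proof -
    have "(\<Sum>s=1..t. ref_loss f xref s (x s j)) = (\<Sum>s=1..t. f s (x s j) - f s xref)"
      by (intro sum.cong) (auto simp: ref_loss_def)
    then have "(\<Sum>s=1..t. ref_loss f xref s (x s j)) + ref_loss f xref t (x (Suc t) j)
        = (\<Sum>s=1..t. f s (x s j)) + f t (x (Suc t) j) - c"
      using False by (simp add: c_def ref_loss_def sum_subtractf)
    then show ?thesis
      by (simp add: mult_exp_exp right_diff_distrib)
  qed
  show ?thesis
    using run_step(3)[of t i] assms False unfolding \<epsilon>_def[symmetric] * sum_distrib_right[symmetric]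
    by simp
qed

text \<open>\<open>weights\<close> also covers the uniform weights of round 1, because
  \<open>ref_loss\<close> with index 0 vanishes; no case distinction on the round is needed.\<close>

lemma weights_simplex:
  assumes "t \<in> {1..T}"
  shows "\<And>i. i \<in> {1..N} \<Longrightarrow> p t i \<ge> 0" "(\<Sum>i=1..N. p t i) = 1"
proof -
  define w where "w i = exp (- meta_rate N f xref x (t - 1) *
      ((\<Sum>s=1..t - 1. ref_loss f xref s (x s i)) + ref_loss f xref (t - 1) (x t i)))" for i
  have p: "p t i = w i / (\<Sum>j\<in>{1..N}. w j)" if "i \<in> {1..N}" for i
  proof -
    have "Suc (t - 1) = t" "t - 1 < T"
      using assms by auto
    then show ?thesis
      using weights[OF _ that, of "t - 1"] unfolding w_def by metis
  qed
  have "(\<Sum>j\<in>{1..N}. w j) > 0"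
    using N_pos by (intro sum_pos) (auto simp: w_def)
  then show "\<And>i. i \<in> {1..N} \<Longrightarrow> p t i \<ge> 0" "(\<Sum>i=1..N. p t i) = 1"
    by (auto simp: p simp flip: sum_divide_distrib) (simp add: w_def)
qed

lemma played_in:
  assumes "t \<in> {1..T}"
  shows "played N (x t) (p t) \<in> X"
  unfolding played_def
  using assms weights_simplex[OF assms] iterates_in convex_X by (intro convex_sum) auto

lemma played_le:
  assumes "t \<in> {1..T}"
  shows "f t (played N (x t) (p t)) \<le> (\<Sum>i=1..N. p t i * f t (x t i))"
  unfolding played_def
  using assms weights_simplex[OF assms] iterates_in N_pos f_convex
  by (intro convex_on_sum[where C = X]) auto

text \<open>The fallback bound, for when no block length below the horizon is good enough or
  \<open>X\<close> is a single point.\<close>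

lemma instantaneous_regret_le:
  assumes "t \<in> {1..T}" "u \<in> X"
  shows "f t (played N (x t) (p t)) - f t u \<le> G * D"
proof -
  have "\<bar>f t (played N (x t) (p t)) - f t u\<bar> \<le> G * norm (played N (x t) (p t) - u)"
    using assms gderiv played_in by (intro gradient_bound_lipschitz[OF convex_X]) auto
  also have "\<dots> \<le> G * D"
    using order_trans[OF norm_ge_zero gderiv(2)[OF assms]]
    by (intro mult_left_mono diam played_in assms)
  finally show ?thesis
    by linarith
qed

text \<open>\<open>a t\<close> is any upper bound for the gradient variation rather than its
  supremum, so that an explicit function of the label estimates can be inserted later.
  \<open>a 1\<close> measures the first gradient against the hint 0, and \<open>D > 0\<close> makes
  the step sizes positive.\<close>

context
  fixes a :: "nat \<Rightarrow> real"
  assumes D: "D > 0" and T: "1 \<le> T"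
    and grad_1: "\<And>y. y \<in> X \<Longrightarrow> norm (gradient (f 1) y) \<le> a 1"
    and grad_variation: "\<And>t y. t \<in> {2..T} \<Longrightarrow> y \<in> X \<Longrightarrow>
          norm (gradient (f t) y - gradient (f (t - 1)) y) \<le> a t"
    and a_le: "\<And>t. t \<in> {1..T} \<Longrightarrow> a t \<le> 2 * G"
begin

text \<open>No implicit update precedes round 1. There the base and projected iterates coincide,
  which is what an update with zero gradient would produce.\<close>

definition hint :: "nat \<Rightarrow> 'a \<Rightarrow> 'a" where
  "hint t y = (if t = 1 then 0 else gradient (f (t - 1)) y)"

lemma hint_error: "t \<in> {1..T} \<Longrightarrow> y \<in> X \<Longrightarrow> norm (gradient (f t) y - hint t y) \<le> a t"
  using grad_1 grad_variation[of t y] by (cases "t = 1") (auto simp: hint_def)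

lemma a_nonneg: "t \<in> {1..T} \<Longrightarrow> a t \<ge> 0"
  using order_trans[OF norm_ge_zero hint_error] xref by blast

lemma a_square_le: "t \<in> {1..T} \<Longrightarrow> (a t)\<^sup>2 \<le> 4 * G\<^sup>2"
  using power_mono[OF a_le a_nonneg, of t 2] by (simp add: power_mult_distrib)

text \<open>The range of variations that the grid of step sizes is designed for.\<close>

lemma variation_le: "(\<Sum>t=1..T. (a t)\<^sup>2) \<le> 4 * real T * G\<^sup>2"
  using sum_bounded_above[of "{1..T}" "\<lambda>t. (a t)\<^sup>2" "4 * G\<^sup>2"] a_square_le by simp

lemma base_step:
  assumes t: "t \<in> {1..T}" and i: "i \<in> {1..N}" and u: "u \<in> X"
  shows "f t (x t i) - f t u \<le> \<eta> i / 2 * (a t)\<^sup>2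
    + ((norm (u - xh t i))\<^sup>2 - (norm (u - xh (t + 1) i))\<^sup>2) / (2 * \<eta> i)"
proof -
  have "1 + 4 * real T * G\<^sup>2 > 0"
    by (intro add_pos_nonneg) auto
  then have \<eta>: "\<eta> i > 0"
    using D by (simp add: step_size_def)
  have x: "x t i \<in> X" and xh: "xh (t + 1) i \<in> X"
    using iterates_in[OF _ i] t by auto
  \<comment> \<open>The iterate \<open>x t i\<close> was produced at the end of round
    \<open>t - 1\<close> by the implicit update with \<open>f (t - 1)\<close> and centre
    \<open>xh t i\<close>; stationarity there involves the gradient of \<open>f (t - 1)\<close> at
    \<open>x t i\<close>, which is the hint.\<close>
  have hint: "\<eta> i * inner (hint t (x t i)) (x t i - xh (t + 1) i) \<le>
    ((norm (xh (t + 1) i - xh t i))\<^sup>2 - (norm (xh (t + 1) i - x t i))\<^sup>2 - (norm (x t i - xh t i))\<^sup>2) / 2"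
  proof (cases "t = 1")
    case True
    then show ?thesis
      using run_init(2)[OF i] by (simp add: hint_def)
  next
    case False
    then have t': "t - 1 \<in> {1..T}" "t - 1 + 1 = t"
      using t by auto
    show ?thesis
      using implicit_update_inequality[OF run_step(2)[OF t'(1) i] convex_X xh gderiv(1)[OF t'(1)] \<eta>]
        x t' False by (simp add: hint_def)
  qed
  have "f t (x t i) - f t u \<le> inner (gradient (f t) (x t i)) (x t i - u)"
    using convex_gradient_inequality[OF f_convex[OF t] gderiv(1)[OF t x] x u] .
  also have "\<dots> \<le> \<eta> i / 2 * (norm (gradient (f t) (x t i) - hint t (x t i)))\<^sup>2
    + ((norm (u - xh t i))\<^sup>2 - (norm (u - xh (t + 1) i))\<^sup>2) / (2 * \<eta> i)"
    by (rule optimistic_step[OF \<eta> projection_inequality[OF run_step(1)[OF t i] convex_X u] hint])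
  also have "\<dots> \<le> \<eta> i / 2 * (a t)\<^sup>2
    + ((norm (u - xh t i))\<^sup>2 - (norm (u - xh (t + 1) i))\<^sup>2) / (2 * \<eta> i)"
    using \<eta> hint_error[OF t x] by (intro add_right_mono mult_left_mono power_mono) auto
  finally show ?thesis .
qed

text \<open>The good step size depends on the number of pieces and on the variation, hence only
  existence of an expert. \<open>k T < T\<close> keeps the number of pieces within the range of the
  grid.\<close>

lemma best_base_regret:
  assumes u: "\<And>t. t \<in> {1..T} \<Longrightarrow> u t \<in> X" "\<And>t. t \<in> {1..T} \<Longrightarrow> u t = v (k t)"
    and k: "k 1 = 0" "mono k" "k T < T"
  shows "\<exists>i\<in>{1..N}. (\<Sum>t=1..T. f t (x t i) - f t (u t))
    \<le> 3 / 2 * D * sqrt (real (k T + 1) * (1 + (\<Sum>t=1..T. (a t)\<^sup>2)))"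
proof -
  define W where "W = (\<Sum>t=1..T. (a t)\<^sup>2)"
  have W: "0 \<le> W" "W \<le> 4 * real T * G\<^sup>2"
    using variation_le by (auto simp: W_def sum_nonneg)
  obtain i where i: "i \<in> {1..N}"
    and le: "\<eta> i / 2 * (1 + W) + D\<^sup>2 * real (k T + 1) / (2 * \<eta> i)
      \<le> 3 / 2 * D * sqrt (real (k T + 1) * (1 + W))"
    using num_experts_grid[OF D _ _ W, of "k T + 1"] k by auto
  have "1 + 4 * real T * G\<^sup>2 > 0"
    by (intro add_pos_nonneg) auto
  then have \<eta>: "\<eta> i > 0"
    using D by (simp add: step_size_def)
  have tel: "(\<Sum>t=1..T. (norm (u t - xh t i))\<^sup>2 - (norm (u t - xh (t + 1) i))\<^sup>2) \<le> D\<^sup>2 * real (k T + 1)"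
    using u k T i by (intro piecewise_constant_telescope[where v = v and k = k] diam iterates_in) auto
  have "(\<Sum>t=1..T. f t (x t i) - f t (u t)) \<le> (\<Sum>t=1..T. \<eta> i / 2 * (a t)\<^sup>2
      + ((norm (u t - xh t i))\<^sup>2 - (norm (u t - xh (t + 1) i))\<^sup>2) / (2 * \<eta> i))"
    by (intro sum_mono base_step i u)
  also have "\<dots> = \<eta> i / 2 * W
      + (\<Sum>t=1..T. (norm (u t - xh t i))\<^sup>2 - (norm (u t - xh (t + 1) i))\<^sup>2) / (2 * \<eta> i)"
    by (simp only: sum.distrib W_def sum_distrib_left sum_divide_distrib)
  also have "\<dots> \<le> \<eta> i / 2 * (1 + W) + D\<^sup>2 * real (k T + 1) / (2 * \<eta> i)"
    using \<eta> tel by (intro add_mono mult_left_mono divide_right_mono) auto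
  also note le
  finally show ?thesis
    using i unfolding W_def by blast
qed

text \<open>The summand of \<open>meta_rate\<close> before squaring: the largest error, over the
  experts, of predicting a loss by its predecessor at the same iterate.\<close>

definition gap :: "nat \<Rightarrow> real" where
  "gap s = (MAX i\<in>{1..N}. \<bar>ref_loss f xref s (x s i) - ref_loss f xref (s - 1) (x s i)\<bar>)"

lemma gap_ge:
  "i \<in> {1..N} \<Longrightarrow> \<bar>ref_loss f xref s (x s i) - ref_loss f xref (s - 1) (x s i)\<bar> \<le> gap s"
  unfolding gap_def by (intro Max_ge) auto

lemma gap_nonneg: "0 \<le> gap s"
  using order_trans[OF abs_ge_zero gap_ge[of 1 s]] N_pos by simp

text \<open>A bound on gradients leaves additive constants of consecutive losses uncontrolled.
  Subtracting the value at \<open>xref\<close> removes them: what remains is the increment of the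
  loss difference between \<open>xref\<close> and \<open>x t i\<close>, two points at distance at
  most \<open>D\<close>.\<close>

lemma gap_le:
  assumes "t \<in> {1..T}"
  shows "gap t \<le> D * a t"
  unfolding gap_def
proof (rule Max.boundedI)
  fix b assume "b \<in> (\<lambda>i. \<bar>ref_loss f xref t (x t i) - ref_loss f xref (t - 1) (x t i)\<bar>) ` {1..N}"
  then obtain i where i: "i \<in> {1..N}"
    and b: "b = \<bar>ref_loss f xref t (x t i) - ref_loss f xref (t - 1) (x t i)\<bar>"
    by blast
  have x: "x t i \<in> X"
    using iterates_in[OF _ i] assms by simp
  define q where "q = (\<lambda>y. f t y - (if t = 1 then 0 else f (t - 1) y))"
  have "GDERIV q y :> gradient (f t) y - hint t y" if "y \<in> X" for y
  proof (cases "t = 1")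
    case True
    then show ?thesis
      using gderiv(1)[OF assms that] by (simp add: q_def hint_def)
  next
    case False
    then have "t - 1 \<in> {1..T}"
      using assms by auto
    then show ?thesis
      using False GDERIV_diff[OF gderiv(1)[OF assms that] gderiv(1)[OF _ that, of "t - 1"]]
      by (simp add: q_def hint_def)
  qed
  then have "\<bar>q (x t i) - q xref\<bar> \<le> a t * norm (x t i - xref)"
    using hint_error[OF assms] x xref
    by (intro gradient_bound_lipschitz[OF convex_X, where g = "\<lambda>y. gradient (f t) y - hint t y"]) auto
  also have "\<dots> \<le> a t * D"
    using a_nonneg[OF assms] by (intro mult_left_mono diam x xref)
  also have "\<bar>q (x t i) - q xref\<bar> = b"
    using assms by (auto simp: b q_def ref_loss_def)
  finally show "b \<le> D * a t"
    by (simp add: mult.commute)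
qed (use N_pos in auto)

text \<open>Optimistic hedge whose hint for an expert is the previous loss at the expert's current
  iterate; the implicit update makes that iterate known before the round is played.\<close>

lemma meta_regret:
  assumes i: "i \<in> {1..N}"
  shows "(\<Sum>t=1..T. f t (played N (x t) (p t)) - f t (x t i))
    \<le> (4 + ln (real N)) * sqrt (1 + D\<^sup>2 * (\<Sum>t=1..T. (a t)\<^sup>2)) + 8 * G\<^sup>2 * D\<^sup>2"
proof -
  define \<epsilon> where "\<epsilon> = meta_rate N f xref x"
  have \<epsilon>: "\<epsilon> = (\<lambda>t. 1 / sqrt (1 + (\<Sum>s=1..t. (gap s)\<^sup>2)))"
    by (simp add: \<epsilon>_def meta_rate_def gap_def fun_eq_iff)
  define V where "V = (\<Sum>t=1..T. (gap t)\<^sup>2)"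
  have sq: "(gap t)\<^sup>2 \<le> D\<^sup>2 * (a t)\<^sup>2" if "t \<in> {1..T}" for t
    using power_mono[OF gap_le[OF that] gap_nonneg, of 2] by (simp add: power_mult_distrib)
  have V: "V \<le> D\<^sup>2 * (\<Sum>t=1..T. (a t)\<^sup>2)"
    unfolding V_def sum_distrib_left by (intro sum_mono sq)
  have pos: "\<epsilon> t > 0" for t
    unfolding \<epsilon> by (intro divide_pos_pos real_sqrt_gt_zero add_pos_nonneg sum_nonneg) auto
  have "antimono \<epsilon>"
    unfolding \<epsilon> antimono_def
    by (intro allI impI divide_left_mono mult_pos_pos real_sqrt_gt_zero real_sqrt_le_mono
        add_left_mono sum_mono2 add_pos_nonneg sum_nonneg) auto
  then have "(\<Sum>t=1..T. \<Sum>j\<in>{1..N}. p t j * ref_loss f xref t (x t j))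
      \<le> (\<Sum>t=1..T. ref_loss f xref t (x t i)) + ln (card {1..N}) / \<epsilon> T
        + 2 * (\<Sum>t=1..T. \<epsilon> (t - 1) * (gap t)\<^sup>2)"
    using pos i gap_ge weights unfolding \<epsilon>_def
    by (intro optimistic_hedge_regret[where m = "\<lambda>t i. ref_loss f xref (t - 1) (x t i)"]) auto
  also have "ln (card {1..N}) / \<epsilon> T = ln (real N) * sqrt (1 + V)"
    by (simp add: \<epsilon> V_def)
  \<comment> \<open>The lagged rates give twice the root, hence 4 in total, plus the bound
    \<open>4 * G^2 * D^2\<close> on a squared gap, hence \<open>8 * G^2 * D^2\<close>.\<close>
  also have "2 * (\<Sum>t=1..T. \<epsilon> (t - 1) * (gap t)\<^sup>2) \<le> 2 * (2 * sqrt (1 + V) + D\<^sup>2 * (4 * G\<^sup>2))"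
    unfolding \<epsilon> V_def using order_trans[OF sq mult_left_mono[OF a_square_le]]
    by (intro mult_left_mono sum_lagged_rate_le) auto
  finally have "(\<Sum>t=1..T. \<Sum>j\<in>{1..N}. p t j * ref_loss f xref t (x t j))
      - (\<Sum>t=1..T. ref_loss f xref t (x t i)) \<le> (4 + ln (real N)) * sqrt (1 + V) + 8 * G\<^sup>2 * D\<^sup>2"
    by (simp add: algebra_simps)
  also have "\<dots> \<le> (4 + ln (real N)) * sqrt (1 + D\<^sup>2 * (\<Sum>t=1..T. (a t)\<^sup>2)) + 8 * G\<^sup>2 * D\<^sup>2"
    using V N_pos by (intro add_right_mono mult_left_mono real_sqrt_le_mono) auto
  finally have *: "(\<Sum>t=1..T. \<Sum>j\<in>{1..N}. p t j * ref_loss f xref t (x t j))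
      - (\<Sum>t=1..T. ref_loss f xref t (x t i))
      \<le> (4 + ln (real N)) * sqrt (1 + D\<^sup>2 * (\<Sum>t=1..T. (a t)\<^sup>2)) + 8 * G\<^sup>2 * D\<^sup>2" .
  \<comment> \<open>The weights sum to 1, so the values at \<open>xref\<close> cancel and the bound
    passes back from \<open>ref_loss\<close> to \<open>f\<close>.\<close>
  have "(\<Sum>t=1..T. f t (played N (x t) (p t)) - f t (x t i))
      \<le> (\<Sum>t=1..T. (\<Sum>j\<in>{1..N}. p t j * ref_loss f xref t (x t j)) - ref_loss f xref t (x t i))"
  proof (intro sum_mono)
    fix t assume t: "t \<in> {1..T}"
    have "(\<Sum>j\<in>{1..N}. p t j * ref_loss f xref t (x t j))
        = (\<Sum>j\<in>{1..N}. p t j * f t (x t j)) - (\<Sum>j\<in>{1..N}. p t j) * f t xref"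
      using t by (simp add: ref_loss_def right_diff_distrib sum_subtractf sum_distrib_right)
    then show "f t (played N (x t) (p t)) - f t (x t i)
        \<le> (\<Sum>j\<in>{1..N}. p t j * ref_loss f xref t (x t j)) - ref_loss f xref t (x t i)"
      using t played_le[OF t] weights_simplex(2)[OF t] by (simp add: ref_loss_def)
  qed
  then show ?thesis
    using * by (simp add: sum_subtractf)
qed

theorem dynamic_regret:
  assumes u: "\<And>t. t \<in> {1..T} \<Longrightarrow> u t \<in> X" "\<And>t. t \<in> {1..T} \<Longrightarrow> u t = v (k t)"
    and k: "k 1 = 0" "mono k" "k T < T"
  shows "(\<Sum>t=1..T. f t (played N (x t) (p t)) - f t (u t))
    \<le> (4 + ln (real N)) * sqrt (1 + D\<^sup>2 * (\<Sum>t=1..T. (a t)\<^sup>2)) + 8 * G\<^sup>2 * D\<^sup>2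
      + 3 / 2 * D * sqrt (real (k T + 1) * (1 + (\<Sum>t=1..T. (a t)\<^sup>2)))"
proof -
  obtain i where i: "i \<in> {1..N}" and le: "(\<Sum>t=1..T. f t (x t i) - f t (u t))
    \<le> 3 / 2 * D * sqrt (real (k T + 1) * (1 + (\<Sum>t=1..T. (a t)\<^sup>2)))"
    using best_base_regret[of u v k] u k by blast
  have "(\<Sum>t=1..T. f t (played N (x t) (p t)) - f t (u t))
      = (\<Sum>t=1..T. f t (played N (x t) (p t)) - f t (x t i)) + (\<Sum>t=1..T. f t (x t i) - f t (u t))"
    by (simp flip: sum.distrib)
  then show ?thesis
    using le meta_regret[OF i] by linarith
qed

end

end

section \<open>Label shift\<close>

lemma norm1_le_norm: "norm1 v \<le> sqrt (real CARD('k)) * norm v" for v :: "real ^ 'k::finite"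
proof -
  have "(norm1 v)\<^sup>2 \<le> (norm v)\<^sup>2 * real CARD('k)"
    using sum_squared_le_sum_of_squares[of "\<lambda>k. \<bar>v $ k\<bar>" UNIV]
    by (simp add: norm1_def norm_vec_def L2_set_def sum_nonneg)
  also have "\<dots> = (sqrt (real CARD('k)) * norm v)\<^sup>2"
    by (simp add: power_mult_distrib)
  finally show ?thesis
    by (rule power2_le_imp_le) simp
qed

lemma norm1_nonneg: "0 \<le> norm1 v"
  by (simp add: norm1_def sum_nonneg)

lemma norm1_add_le: "norm1 (v + w) \<le> norm1 v + norm1 w"
  unfolding norm1_def by (simp flip: sum.distrib) (intro sum_mono abs_triangle_ineq)

lemma norm1_diff_le_variation:
  fixes \<mu> :: "nat \<Rightarrow> real ^ 'k::finite"
  assumes "s \<le> t"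
  shows "norm1 (\<mu> t - \<mu> s) \<le> (\<Sum>r=s+1..t. norm1 (\<mu> r - \<mu> (r - 1)))"
  using assms
proof (induction t rule: dec_induct)
  case base
  then show ?case
    by (simp add: norm1_def)
next
  case (step t)
  then show ?case
    using norm1_add_le[of "\<mu> t - \<mu> s" "\<mu> (Suc t) - \<mu> t"] by simp
qed

text \<open>Cauchy-Schwarz over the labels and again over the rounds. This ties the path length
  \<open>L\<close> to \<open>V\<close>, which later absorbs the rounding of the block
  length.\<close>

lemma sum_norm1_square_le:
  fixes v :: "nat \<Rightarrow> real ^ 'k::finite"
  shows "(\<Sum>t=2..T. norm1 (v t))\<^sup>2 \<le> real CARD('k) * real T * (\<Sum>t=1..T. (norm (v t))\<^sup>2)"
proof -
  have "(\<Sum>t=2..T. norm1 (v t))\<^sup>2 \<le> (\<Sum>t=1..T. norm1 (v t))\<^sup>2"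
    by (intro power_mono sum_mono2 sum_nonneg norm1_nonneg) auto
  also have "\<dots> \<le> (\<Sum>t=1..T. (norm1 (v t))\<^sup>2) * real T"
    using sum_squared_le_sum_of_squares[of "\<lambda>t. norm1 (v t)" "{1..T}"] by simp
  also have "\<dots> \<le> (\<Sum>t=1..T. real CARD('k) * (norm (v t))\<^sup>2) * real T"
    using power_mono[OF norm1_le_norm norm1_nonneg, where n = 2]
    by (intro mult_right_mono sum_mono) (simp_all add: power_mult_distrib)
  finally show ?thesis
    by (simp add: mult_ac flip: sum_distrib_left)
qed

lemma matrix_inv_left:
  assumes "invertible A"
  shows "matrix_inv A ** A = mat 1"
  using assms unfolding invertible_def matrix_inv_def by (metis (mono_tags, lifting) someI_ex)

lemma space_feature_space [simp]: "space (feature_space Z) = Z"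
  by (simp add: feature_space_def space_restrict_space)

lemma label_event_in_sets:
  assumes "sets P = sets (feature_space Z \<Otimes>\<^sub>M count_space UNIV)"
  shows "{w \<in> space P. snd w = k} \<in> sets P"
proof -
  have "snd \<in> P \<rightarrow>\<^sub>M count_space UNIV"
    using measurable_snd by (simp add: measurable_cong_sets[OF assms refl])
  from measurable_sets[OF this, of "{k}"] show ?thesis
    by (simp add: vimage_def Int_def conj_commute)
qed

lemma measurable_feature:
  assumes "sets P = sets (feature_space Z \<Otimes>\<^sub>M count_space UNIV)"
  shows "fst \<in> P \<rightarrow>\<^sub>M feature_space Z"
  using measurable_fst by (simp add: measurable_cong_sets[OF assms refl])

context
  fixes P :: "('z::topological_space \<times> 'k::finite) measure" and Z :: "'z set" and k :: 'k
  assumes P: "prob_space P" "sets P = sets (feature_space Z \<Otimes>\<^sub>M count_space UNIV)"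
    and pos: "label_vec P $ k > 0"
begin

lemma emeasure_label_event:
  "emeasure P {w \<in> space P. snd w = k} \<noteq> 0" "emeasure P {w \<in> space P. snd w = k} \<noteq> \<infinity>"
proof -
  interpret prob_space P by fact
  show "emeasure P {w \<in> space P. snd w = k} \<noteq> 0" "emeasure P {w \<in> space P. snd w = k} \<noteq> \<infinity>"
    using pos by (auto simp: label_vec_def measure_def)
qed

lemma measurable_feature_uniform:
  "fst \<in> uniform_measure P {w \<in> space P. snd w = k} \<rightarrow>\<^sub>M feature_space Z"
  using measurable_feature[OF P(2)] by simp

lemma prob_space_class_cond: "prob_space (class_cond Z P k)"
  unfolding class_cond_def
  by (intro prob_space.prob_space_distr prob_space_uniform_measure emeasure_label_event
      measurable_feature_uniform)

lemma abs_class_risk_le: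
  assumes "\<And>z. z \<in> Z \<Longrightarrow> \<bar>l (h y z) k\<bar> \<le> B" "0 \<le> B"
  shows "\<bar>class_risk Z P h l k y\<bar> \<le> B"
proof -
  interpret C: prob_space "class_cond Z P k"
    by (rule prob_space_class_cond)
  have space: "space (class_cond Z P k) = Z"
    by (simp add: class_cond_def)
  show ?thesis
  \<comment> \<open>Otherwise the integral has the default value 0, which \<open>0 \<le> B\<close>
    covers.\<close>
  proof (cases "integrable (class_cond Z P k) (\<lambda>z. l (h y z) k)")
    case True
    have "l (h y z) k \<le> B" "- B \<le> l (h y z) k" if "z \<in> Z" for z
      using assms(1)[OF that] by linarith+
    then have "(\<integral>z. l (h y z) k \<partial>class_cond Z P k) \<le> B" "- B \<le> (\<integral>z. l (h y z) k \<partial>class_cond Z P k)"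
      using True by (auto intro!: C.integral_le_const C.integral_ge_const AE_I2 simp: space)
    then show ?thesis
      unfolding class_risk_def by linarith
  qed (use assms in \<open>simp add: class_risk_def not_integrable_integral_eq\<close>)
qed

text \<open>A confusion entry is the conditional probability of a prediction given the label; times
  the label probability it becomes a joint probability, which can be summed over the labels.\<close>

lemma confusion_mult_label:
  assumes "h0 \<in> feature_space Z \<rightarrow>\<^sub>M count_space UNIV"
  shows "confusion Z P h0 $ i $ k * label_vec P $ k
    = measure P {w \<in> space P. h0 (fst w) = i \<and> snd w = k}"
proof -
  interpret prob_space P by fact
  define A where "A = {w \<in> space P. snd w = k}"
  have A: "emeasure P A \<noteq> 0" "emeasure P A \<noteq> \<infinity>" "measure P A \<noteq> 0"
    using emeasure_label_event pos by (auto simp: A_def label_vec_def)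
  define E where "E = {z \<in> Z. h0 z = i}"
  have E: "E \<in> sets (feature_space Z)"
    using measurable_sets[OF assms, of "{i}"] by (simp add: E_def vimage_def Int_def conj_commute)
  have EZ: "E \<inter> Z = E"
    by (auto simp: E_def)
  have pre: "fst -` E \<inter> space P = {w \<in> space P. h0 (fst w) = i}"
    using measurable_space[OF measurable_feature[OF P(2)]] by (auto simp: E_def)
  have pre_sets: "{w \<in> space P. h0 (fst w) = i} \<in> sets P"
    using measurable_sets[OF measurable_feature[OF P(2)] E] pre by simp
  have "confusion Z P h0 $ i $ k = (\<integral>z. of_bool (h0 z = i) \<partial>class_cond Z P k)"
    by (simp add: confusion_def)
  also have "\<dots> = (\<integral>z. indicator E z \<partial>class_cond Z P k)"
    by (intro Bochner_Integration.integral_cong) (auto simp: class_cond_def E_def indicator_def)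
  also have "\<dots> = measure (class_cond Z P k) E"
    using E EZ by (simp add: class_cond_def)
  also have "\<dots> = measure (uniform_measure P A) (fst -` E \<inter> space P)"
    unfolding class_cond_def A_def by (subst measure_distr) (use E measurable_feature_uniform in auto)
  also have "\<dots> = measure P (A \<inter> {w \<in> space P. h0 (fst w) = i}) / measure P A"
    unfolding pre by (intro measure_uniform_measure A pre_sets)
  also have "A \<inter> {w \<in> space P. h0 (fst w) = i} = {w \<in> space P. h0 (fst w) = i \<and> snd w = k}"
    by (auto simp: A_def)
  finally show ?thesis
    using A by (simp add: label_vec_def A_def)
qed

end

locale label_stream = prob_space M for M :: "'w measure" +
  fixes Z :: "'z::topological_space set" and P :: "nat \<Rightarrow> ('z \<times> 'k::finite) measure"
    and S0 :: "('z \<times> 'k) list" and h0 :: "'z \<Rightarrow> 'k" and T :: nat and m :: "nat \<Rightarrow> nat"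
    and zs :: "nat \<Rightarrow> nat \<Rightarrow> 'w \<Rightarrow> 'z"
  assumes P_prob: "\<And>t. t \<le> T \<Longrightarrow> prob_space (P t)"
    and P_sets: "\<And>t. t \<le> T \<Longrightarrow> sets (P t) = sets (feature_space Z \<Otimes>\<^sub>M count_space UNIV)"
    and P_shift: "\<And>t k. t \<le> T \<Longrightarrow> label_vec (P t) $ k > 0 \<Longrightarrow>
                    class_cond Z (P t) k = class_cond Z (P 0) k"
    and h0_meas: "h0 \<in> feature_space Z \<rightarrow>\<^sub>M count_space UNIV"
    and C_inv: "invertible (confusion Z (P 0) h0)"
    and C_exact: "emp_confusion S0 h0 = confusion Z (P 0) h0"
    and m_pos: "\<And>t. t \<in> {1..T} \<Longrightarrow> m t \<ge> 1"
    and zs_meas: "\<And>t n. t \<in> {1..T} \<Longrightarrow> n < m t \<Longrightarrow> zs t n \<in> M \<rightarrow>\<^sub>M feature_space Z"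
    and zs_law: "\<And>t n. t \<in> {1..T} \<Longrightarrow> n < m t \<Longrightarrow>
                   distr M (feature_space Z) (zs t n) = distr (P t) (feature_space Z) fst"
begin

definition sample :: "nat \<Rightarrow> 'w \<Rightarrow> 'z list" where
  "sample t \<omega> = map (\<lambda>n. zs t n \<omega>) [0..<m t]"

text \<open>The law of total probability over the labels, with label shift replacing the
  class-conditional laws of round \<open>t\<close> by those of round 0.\<close>

lemma prediction_prob:
  assumes "t \<le> T"
  shows "measure (P t) {w \<in> space (P t). h0 (fst w) = i}
    = (confusion Z (P 0) h0 *v label_vec (P t)) $ i"
proof -
  interpret Pt: prob_space "P t"
    using P_prob[OF assms] .
  define A where "A k = {w \<in> space (P t). h0 (fst w) = i \<and> snd w = k}" for k
  have f: "(\<lambda>w. h0 (fst w)) \<in> P t \<rightarrow>\<^sub>M count_space UNIV"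
    using measurable_compose[OF measurable_feature[OF P_sets[OF assms]] h0_meas] .
  have "{w \<in> space (P t). h0 (fst w) = i} \<in> sets (P t)"
    using measurable_sets[OF f, of "{i}"] by (simp add: vimage_def Int_def conj_commute)
  moreover have A_Int: "A k = {w \<in> space (P t). h0 (fst w) = i} \<inter> {w \<in> space (P t). snd w = k}" for k
    by (auto simp: A_def)
  ultimately have A_sets: "A k \<in> sets (P t)" for k
    using label_event_in_sets[OF P_sets[OF assms]] by auto
  have joint: "measure (P t) (A k) = confusion Z (P 0) h0 $ i $ k * label_vec (P t) $ k" for k
  proof (cases "label_vec (P t) $ k > 0")
    case True
    have "confusion Z (P 0) h0 $ i $ k = confusion Z (P t) h0 $ i $ k"
      using P_shift[OF assms True] by (simp add: confusion_def)
    then show ?thesis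
      using confusion_mult_label[OF P_prob[OF assms] P_sets[OF assms] True h0_meas]
      by (simp add: A_def)
  next
    \<comment> \<open>Conditioning on a null label is meaningless, but then the joint event is null
      as well and both sides vanish.\<close>
    case False
    then have "measure (P t) {w \<in> space (P t). snd w = k} = 0"
      using measure_nonneg[of "P t"] by (simp add: label_vec_def not_less order_antisym)
    moreover have "measure (P t) (A k) \<le> measure (P t) {w \<in> space (P t). snd w = k}"
      using label_event_in_sets[OF P_sets[OF assms]]
      by (intro Pt.finite_measure_mono) (auto simp: A_def)
    ultimately show ?thesis
      using measure_nonneg[of "P t" "A k"] by (simp add: label_vec_def)
  qed
  have "{w \<in> space (P t). h0 (fst w) = i} = (\<Union>k\<in>UNIV. A k)"
    by (auto simp: A_def)
  then have "measure (P t) {w \<in> space (P t). h0 (fst w) = i} = (\<Sum>k\<in>UNIV. measure (P t) (A k))"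
    using A_sets
    by (simp only:) (intro Pt.finite_measure_finite_Union, auto simp: disjoint_family_on_def A_def)
  then show ?thesis
    by (simp add: joint matrix_vector_mult_def)
qed

lemma pred_freq_sample:
  "pred_freq h0 (sample t \<omega>) $ j = (\<Sum>n<m t. of_bool (h0 (zs t n \<omega>) = j)) / real (m t)"
  by (simp add: pred_freq_def sample_def o_def interv_sum_list_conv_sum_set_nat atLeast0LessThan)

lemma pred_measurable:
  assumes "t \<in> {1..T}" "n < m t"
  shows "(\<lambda>\<omega>. of_bool (h0 (zs t n \<omega>) = j) :: real) \<in> borel_measurable M"
  using measurable_compose[OF measurable_compose[OF zs_meas[OF assms] h0_meas],
      of "\<lambda>i. of_bool (i = j) :: real" borel] by simp

lemma pred_mean:
  assumes "t \<in> {1..T}" "n < m t"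
  shows "(\<integral>\<omega>. of_bool (h0 (zs t n \<omega>) = j) \<partial>M) = (confusion Z (P 0) h0 *v label_vec (P t)) $ j"
proof -
  define E where "E = {z \<in> Z. h0 z = j}"
  have E: "E \<in> sets (feature_space Z)"
    using measurable_sets[OF h0_meas, of "{j}"] by (simp add: E_def vimage_def Int_def conj_commute)
  have t: "t \<le> T"
    using assms by simp
  have fst: "fst \<in> P t \<rightarrow>\<^sub>M feature_space Z"
    using measurable_feature[OF P_sets[OF t]] .
  have "(\<integral>\<omega>. of_bool (h0 (zs t n \<omega>) = j) \<partial>M) = (\<integral>\<omega>. indicator E (zs t n \<omega>) \<partial>M :: real)"
    using measurable_space[OF zs_meas[OF assms]]
    by (intro Bochner_Integration.integral_cong) (auto simp: E_def indicator_def)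
  also have "\<dots> = (\<integral>z. indicator E z \<partial>distr M (feature_space Z) (zs t n))"
    using E by (intro integral_distr[symmetric] zs_meas assms) auto
  also have "\<dots> = measure (distr (P t) (feature_space Z) fst) E"
    using E Int_absorb2[of E Z] by (simp add: zs_law[OF assms]) (simp add: E_def)
  also have "\<dots> = measure (P t) (fst -` E \<inter> space (P t))"
    by (intro measure_distr fst E)
  also have "fst -` E \<inter> space (P t) = {w \<in> space (P t). h0 (fst w) = j}"
    using measurable_space[OF fst] by (auto simp: E_def)
  finally show ?thesis
    using prediction_prob[OF t] by simp
qed

definition est :: "nat \<Rightarrow> 'w \<Rightarrow> real ^ 'k" where
  "est t \<omega> = label_est S0 h0 (sample t \<omega>)"

lemma est_nth:
  "est t \<omega> $ k = (\<Sum>j\<in>UNIV. matrix_inv (confusion Z (P 0) h0) $ k $ j *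
     ((\<Sum>n<m t. of_bool (h0 (zs t n \<omega>) = j)) / real (m t)))"
  by (simp add: est_def label_est_def C_exact matrix_vector_mult_def pred_freq_sample)

lemma est_nth_measurable:
  assumes "t \<in> {1..T}"
  shows "(\<lambda>\<omega>. est t \<omega> $ k) \<in> borel_measurable M"
  unfolding est_nth
  by (intro borel_measurable_sum borel_measurable_times borel_measurable_divide
      borel_measurable_const pred_measurable[OF assms]) simp

lemma est_measurable:
  assumes "t \<in> {1..T}"
  shows "est t \<in> borel_measurable M"
  unfolding borel_measurable_euclidean_space[of "est t"]
  using est_nth_measurable[OF assms] by (auto simp: Basis_vec_def inner_axis)

text \<open>Frequencies lie between 0 and 1, also for an empty sample since division by zero gives
  0, so the entries of the inverse confusion matrix give a uniform bound. Integrability of estimates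
  and errors rests on it.\<close>

lemma est_bounded: "\<exists>b. \<forall>t \<omega>. norm (est t \<omega>) \<le> b"
proof (intro exI allI)
  fix t \<omega>
  have "\<bar>est t \<omega> $ k\<bar> \<le> (\<Sum>j\<in>UNIV. \<bar>matrix_inv (confusion Z (P 0) h0) $ k $ j\<bar>)" for k
    unfolding est_nth
  proof (rule order_trans[OF sum_abs sum_mono])
    fix j
    have "(\<Sum>n<m t. of_bool (h0 (zs t n \<omega>) = j)) \<le> (\<Sum>n<m t. 1::real)"
      by (intro sum_mono) auto
    then have "\<bar>(\<Sum>n<m t. of_bool (h0 (zs t n \<omega>) = j)) / real (m t)\<bar> \<le> 1"
      by (simp add: sum_nonneg divide_le_eq)
    then show "\<bar>matrix_inv (confusion Z (P 0) h0) $ k $ j *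
        ((\<Sum>n<m t. of_bool (h0 (zs t n \<omega>) = j)) / real (m t))\<bar>
        \<le> \<bar>matrix_inv (confusion Z (P 0) h0) $ k $ j\<bar>"
      unfolding abs_mult by (intro mult_left_le) auto
  qed
  then show "norm (est t \<omega>) \<le> (\<Sum>k\<in>UNIV. \<Sum>j\<in>UNIV. \<bar>matrix_inv (confusion Z (P 0) h0) $ k $ j\<bar>)"
    by (intro order_trans[OF norm_le_l1_cart] sum_mono)
qed

lemma est_nth_integrable:
  assumes "t \<in> {1..T}"
  shows "integrable M (\<lambda>\<omega>. est t \<omega> $ k)"
proof -
  obtain b where b: "\<And>\<omega>. norm (est t \<omega>) \<le> b"
    using est_bounded by blast
  show ?thesis
    using order_trans[OF component_le_norm_cart b]
    by (intro integrable_const_bound[where B = b] est_nth_measurable assms) auto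
qed

text \<open>The estimate is linear in the indicators of single predictions. Their means form the
  confusion matrix applied to the label vector, and the inverse matrix undoes this.\<close>

lemma est_unbiased:
  assumes t: "t \<in> {1..T}"
  shows "(\<integral>\<omega>. est t \<omega> $ k \<partial>M) = label_vec (P t) $ k"
proof -
  let ?C = "confusion Z (P 0) h0"
  have int: "integrable M (\<lambda>\<omega>. of_bool (h0 (zs t n \<omega>) = j) :: real)" if "n < m t" for n j
    by (intro integrable_const_bound[where B = 1] pred_measurable t that) auto
  have "(\<integral>\<omega>. est t \<omega> $ k \<partial>M) = (\<Sum>j\<in>UNIV. matrix_inv ?C $ k $ j *
      ((\<Sum>n<m t. \<integral>\<omega>. of_bool (h0 (zs t n \<omega>) = j) \<partial>M) / real (m t)))"
    unfolding est_nth
    by (subst Bochner_Integration.integral_sum)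
      (auto intro!: integrable_mult_right integrable_divide Bochner_Integration.integrable_sum int
        simp: Bochner_Integration.integral_sum int simp del: sum_of_bool_eq)
  also have "\<dots> = (\<Sum>j\<in>UNIV. matrix_inv ?C $ k $ j * (?C *v label_vec (P t)) $ j)"
    using pred_mean[OF t] m_pos[OF t] by simp
  also have "\<dots> = (matrix_inv ?C *v (?C *v label_vec (P t))) $ k"
    by (simp add: matrix_vector_mult_def[of "matrix_inv ?C"])
  also have "\<dots> = label_vec (P t) $ k"
    by (simp add: matrix_vector_mul_assoc matrix_inv_left[OF C_inv])
  finally show ?thesis .
qed

end

text \<open>Jensen's inequality through the tangent of the square root at
  \<open>c^2\<close>.\<close>

lemma (in prob_space) expectation_sqrt_le:
  assumes "integrable M Y" "expectation Y \<le> c\<^sup>2" "c > 0" "\<And>\<omega>. \<omega> \<in> space M \<Longrightarrow> 0 \<le> Y \<omega>"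
  shows "expectation (\<lambda>\<omega>. sqrt (Y \<omega>)) \<le> c"
proof (cases "integrable M (\<lambda>\<omega>. sqrt (Y \<omega>))")
  case True
  have "expectation (\<lambda>\<omega>. sqrt (Y \<omega>)) \<le> expectation (\<lambda>\<omega>. (Y \<omega> / c + c) / 2)"
  proof (rule integral_mono)
    fix \<omega> assume "\<omega> \<in> space M"
    then have Y: "Y \<omega> = sqrt (Y \<omega>) * sqrt (Y \<omega>)"
      using assms by simp
    have "0 \<le> (sqrt (Y \<omega>) - c)\<^sup>2"
      by simp
    then have "2 * c * sqrt (Y \<omega>) \<le> Y \<omega> + c\<^sup>2"
      using Y by (simp add: power2_eq_square algebra_simps)
    then show "sqrt (Y \<omega>) \<le> (Y \<omega> / c + c) / 2"
      using \<open>c > 0\<close> by (simp add: field_simps power2_eq_square)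
  qed (use True assms in auto)
  also have "\<dots> = (expectation Y / c + c) / 2"
    using assms by (simp add: prob_space)
  also have "\<dots> \<le> (c\<^sup>2 / c + c) / 2"
    using assms by (intro divide_right_mono add_right_mono) auto
  also have "\<dots> = c"
    using \<open>c > 0\<close> by (simp add: power2_eq_square)
  finally show ?thesis .
qed (use assms in \<open>simp add: not_integrable_integral_eq\<close>)

lemma norm_add3_square_le: "(norm (a + b + c))\<^sup>2 \<le> 3 * ((norm a)\<^sup>2 + (norm b)\<^sup>2 + (norm c)\<^sup>2)"
  for a b c :: "'a::real_normed_vector"
proof -
  have "norm (a + b + c) \<le> norm a + norm b + norm c"
    using norm_triangle_ineq[of "a + b" c] norm_triangle_ineq[of a b] by linarith
  then have "(norm (a + b + c))\<^sup>2 \<le> (norm a + norm b + norm c)\<^sup>2"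
    by (intro power_mono) auto
  also have "\<dots> = 3 * ((norm a)\<^sup>2 + (norm b)\<^sup>2 + (norm c)\<^sup>2)
      - ((norm a - norm b)\<^sup>2 + (norm b - norm c)\<^sup>2 + (norm a - norm c)\<^sup>2)"
    by (simp add: power2_eq_square algebra_simps)
  also have "\<dots> \<le> 3 * ((norm a)\<^sup>2 + (norm b)\<^sup>2 + (norm c)\<^sup>2)"
    using zero_le_power2[of "norm a - norm b"] zero_le_power2[of "norm b - norm c"]
      zero_le_power2[of "norm a - norm c"] by linarith
  finally show ?thesis .
qed

lemma sum_shift_le:
  fixes e :: "nat \<Rightarrow> real"
  assumes "\<And>t. 0 \<le> e t"
  shows "(\<Sum>t=2..T. e (t - 1)) \<le> (\<Sum>t=1..T. e t)"
proof -
  have "(\<Sum>t=2..T. e (t - 1)) = sum e ((\<lambda>t. t - 1) ` {2..T})"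
    by (subst sum.reindex) (auto simp: inj_on_def)
  also have "\<dots> \<le> sum e {1..T}"
    using assms by (intro sum_mono2) auto
  finally show ?thesis .
qed

context label_stream
begin

lemma est_error_integrable:
  assumes "t \<in> {1..T}"
  shows "integrable M (\<lambda>\<omega>. (norm (est t \<omega> - v))\<^sup>2)"
proof -
  obtain b where b: "\<And>\<omega>. norm (est t \<omega>) \<le> b"
    using est_bounded by blast
  have "norm (est t \<omega> - v) \<le> b + norm v" for \<omega>
    using norm_triangle_ineq4[of "est t \<omega>" v] b[of \<omega>] by linarith
  then show ?thesis
    using est_measurable[OF assms]
    by (intro integrable_const_bound[where B = "(b + norm v)\<^sup>2"]) (auto intro!: AE_I2 power_mono)
qed

text \<open>The bound inserted for \<open>a t\<close>. It depends on the outcome only through the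
  estimates, so measurability is inherited from them. The minimum with \<open>2 * G\<close> keeps
  the variation within the step-size grid; round 1 is compared with the hint 0.\<close>

definition grad_step :: "real \<Rightarrow> 'w \<Rightarrow> nat \<Rightarrow> real" where
  "grad_step G \<omega> t = (if t = 1 then G
     else min (2 * G) (sqrt (real CARD('k)) * G * norm (est t \<omega> - est (t - 1) \<omega>)))"

lemma grad_step_nonneg: "0 \<le> G \<Longrightarrow> 0 \<le> grad_step G \<omega> t"
  by (simp add: grad_step_def)

lemma grad_step_le: "0 \<le> G \<Longrightarrow> grad_step G \<omega> t \<le> 2 * G"
  by (simp add: grad_step_def)

lemma grad_step_square_integrable:
  assumes "0 \<le> G"
  shows "integrable M (\<lambda>\<omega>. \<Sum>t=1..T. (grad_step G \<omega> t)\<^sup>2)"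
proof (intro Bochner_Integration.integrable_sum integrable_const_bound[where B = "(2 * G)\<^sup>2"])
  fix t assume t: "t \<in> {1..T}"
  show "AE \<omega> in M. norm ((grad_step G \<omega> t)\<^sup>2) \<le> (2 * G)\<^sup>2"
  proof (rule AE_I2)
    fix \<omega>
    have "(grad_step G \<omega> t)\<^sup>2 \<le> (2 * G)\<^sup>2"
      by (intro power_mono grad_step_le grad_step_nonneg assms)
    then show "norm ((grad_step G \<omega> t)\<^sup>2) \<le> (2 * G)\<^sup>2"
      by simp
  qed
  show "(\<lambda>\<omega>. (grad_step G \<omega> t)\<^sup>2) \<in> borel_measurable M"
  proof (cases "t = 1")
    case False
    then have [measurable]: "est t \<in> borel_measurable M" "est (t - 1) \<in> borel_measurable M"
      using t by (auto intro!: est_measurable)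
    have "(\<lambda>\<omega>. (grad_step G \<omega> t)\<^sup>2) = (\<lambda>\<omega>. (min (2 * G)
        (sqrt (real CARD('k)) * G * norm (est t \<omega> - est (t - 1) \<omega>)))\<^sup>2)"
      using False by (simp add: grad_step_def)
    then show ?thesis
      by (simp only:) measurable
  qed (simp add: grad_step_def)
qed

text \<open>The change of the estimate is the error of round \<open>t\<close>, the true drift and
  the error of round \<open>t - 1\<close>. Squaring three summands gives a factor 3, and every error
  serves two consecutive rounds, hence 6.\<close>

lemma expectation_grad_steps_le:
  assumes "0 \<le> G" "1 \<le> T"
  shows "expectation (\<lambda>\<omega>. \<Sum>t=1..T. (grad_step G \<omega> t)\<^sup>2) \<le> G\<^sup>2 + 6 * real CARD('k) * G\<^sup>2 *
    ((\<Sum>t=1..T. expectation (\<lambda>\<omega>. (norm (est t \<omega> - label_vec (P t)))\<^sup>2))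
      + (\<Sum>t=1..T. (norm (label_vec (P t) - label_vec (P (t - 1))))\<^sup>2))"
proof -
  define c where "c = real CARD('k) * G\<^sup>2"
  have c: "c \<ge> 0"
    by (simp add: c_def)
  define e where "e \<omega> t = (norm (est t \<omega> - label_vec (P t)))\<^sup>2" for \<omega> t
  define q where "q t = (norm (label_vec (P t) - label_vec (P (t - 1))))\<^sup>2" for t
  have q: "(\<Sum>t=2..T. q t) \<le> (\<Sum>t=1..T. q t)" "0 \<le> (\<Sum>t=1..T. q t)"
    by (auto intro!: sum_mono2 sum_nonneg simp: q_def)
  have e: "(\<Sum>t=2..T. e \<omega> t) \<le> (\<Sum>t=1..T. e \<omega> t)" for \<omega>
    by (auto intro!: sum_mono2 simp: e_def)
  have pt: "(\<Sum>t=1..T. (grad_step G \<omega> t)\<^sup>2) \<le> G\<^sup>2 + 6 * c * ((\<Sum>t=1..T. e \<omega> t) + (\<Sum>t=1..T. q t))" for \<omega>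
  proof -
    have "(grad_step G \<omega> t)\<^sup>2 \<le> 3 * c * (e \<omega> t + q t + e \<omega> (t - 1))" if "t \<in> {2..T}" for t
    proof -
      have "(grad_step G \<omega> t)\<^sup>2 \<le> (sqrt (real CARD('k)) * G * norm (est t \<omega> - est (t - 1) \<omega>))\<^sup>2"
        using that grad_step_nonneg[OF \<open>0 \<le> G\<close>, of \<omega> t]
        by (intro power_mono) (auto simp: grad_step_def)
      also have "\<dots> = c * (norm ((est t \<omega> - label_vec (P t)) + (label_vec (P t) - label_vec (P (t - 1)))
          + (label_vec (P (t - 1)) - est (t - 1) \<omega>)))\<^sup>2"
        by (simp add: power_mult_distrib c_def)
      also have "\<dots> \<le> c * (3 * (e \<omega> t + q t + (norm (label_vec (P (t - 1)) - est (t - 1) \<omega>))\<^sup>2))"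
        using c unfolding e_def q_def by (intro mult_left_mono norm_add3_square_le)
      finally show ?thesis
        by (simp add: e_def norm_minus_commute mult_ac)
    qed
    then have "(\<Sum>t=2..T. (grad_step G \<omega> t)\<^sup>2) \<le> (\<Sum>t=2..T. 3 * c * (e \<omega> t + q t + e \<omega> (t - 1)))"
      by (intro sum_mono) auto
    also have "\<dots> = 3 * c * ((\<Sum>t=2..T. e \<omega> t) + (\<Sum>t=2..T. q t) + (\<Sum>t=2..T. e \<omega> (t - 1)))"
        by (simp only: sum_distrib_left[symmetric] sum.distrib)
    also have "\<dots> \<le> 3 * c * ((\<Sum>t=1..T. e \<omega> t) + 2 * (\<Sum>t=1..T. q t) + (\<Sum>t=1..T. e \<omega> t))"
      using c q e[of \<omega>] sum_shift_le[of "e \<omega>" T] by (intro mult_left_mono add_mono) (auto simp: e_def)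
    finally have "(\<Sum>t=2..T. (grad_step G \<omega> t)\<^sup>2) \<le> 6 * c * ((\<Sum>t=1..T. e \<omega> t) + (\<Sum>t=1..T. q t))"
      by (simp add: algebra_simps)
    moreover have "(\<Sum>t=1..T. (grad_step G \<omega> t)\<^sup>2) = (grad_step G \<omega> 1)\<^sup>2 + (\<Sum>t=2..T. (grad_step G \<omega> t)\<^sup>2)"
      using \<open>1 \<le> T\<close> by (simp add: sum.atLeast_Suc_atMost numeral_2_eq_2)
    ultimately show ?thesis
      by (simp add: grad_step_def)
  qed
  have int: "integrable M (\<lambda>\<omega>. e \<omega> t)" if "t \<in> {1..T}" for t
    unfolding e_def by (rule est_error_integrable[OF that])
  have "expectation (\<lambda>\<omega>. \<Sum>t=1..T. (grad_step G \<omega> t)\<^sup>2)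
      \<le> expectation (\<lambda>\<omega>. G\<^sup>2 + 6 * c * ((\<Sum>t=1..T. e \<omega> t) + (\<Sum>t=1..T. q t)))"
    by (intro integral_mono grad_step_square_integrable[OF \<open>0 \<le> G\<close>] pt integrable_const
        integrable_mult_right Bochner_Integration.integrable_add Bochner_Integration.integrable_sum int)
  also have "\<dots> = G\<^sup>2 + 6 * c * ((\<Sum>t=1..T. expectation (\<lambda>\<omega>. e \<omega> t)) + (\<Sum>t=1..T. q t))"
  proof -
    have "integrable M (\<lambda>\<omega>. \<Sum>t=1..T. e \<omega> t)"
      by (rule Bochner_Integration.integrable_sum[OF int])
    moreover have "expectation (\<lambda>\<omega>. \<Sum>t=1..T. e \<omega> t) = (\<Sum>t=1..T. expectation (\<lambda>\<omega>. e \<omega> t))"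
      by (rule Bochner_Integration.integral_sum[OF int])
    ultimately show ?thesis
      by (simp add: prob_space)
  qed
  finally show ?thesis
    by (simp add: c_def e_def q_def mult.assoc)
qed

end

section \<open>Piecewise constant comparators\<close>

definition block_start :: "nat \<Rightarrow> nat \<Rightarrow> nat" where
  "block_start \<Delta> t = ((t - 1) div \<Delta>) * \<Delta> + 1"

lemma block_start_bounds:
  assumes "1 \<le> \<Delta>" "1 \<le> t"
  shows "1 \<le> block_start \<Delta> t" "block_start \<Delta> t \<le> t" "t < block_start \<Delta> t + \<Delta>"
proof -
  have "(t - 1) div \<Delta> * \<Delta> + (t - 1) mod \<Delta> = t - 1" "(t - 1) mod \<Delta> < \<Delta>"
    using assms by auto
  then show "1 \<le> block_start \<Delta> t" "block_start \<Delta> t \<le> t" "t < block_start \<Delta> t + \<Delta>"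
    using assms unfolding block_start_def by linarith+
qed

text \<open>Exchange the sums: the change at round \<open>r\<close> is counted only by later rounds
  of its own block, which lie among the \<Delta> rounds from \<open>r\<close> on.\<close>

lemma sum_block_variation_le:
  fixes g :: "nat \<Rightarrow> real"
  assumes "1 \<le> \<Delta>" "\<And>r. 0 \<le> g r"
  shows "(\<Sum>t=1..T. \<Sum>r=block_start \<Delta> t + 1..t. g r) \<le> real \<Delta> * (\<Sum>r=2..T. g r)"
proof -
  have "(\<Sum>t=1..T. \<Sum>r=block_start \<Delta> t + 1..t. g r)
      = (\<Sum>t=1..T. \<Sum>r=2..T. if r \<in> {block_start \<Delta> t + 1..t} then g r else 0)"
  proof (rule sum.cong)
    fix t assume "t \<in> {1..T}"
    then have "{block_start \<Delta> t + 1..t} = {2..T} \<inter> {block_start \<Delta> t + 1..t}"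
      using block_start_bounds[OF assms(1), of t] by auto
    then show "(\<Sum>r=block_start \<Delta> t + 1..t. g r)
        = (\<Sum>r=2..T. if r \<in> {block_start \<Delta> t + 1..t} then g r else 0)"
      by (metis finite_atLeastAtMost sum.inter_restrict)
  qed simp
  also have "\<dots> = (\<Sum>r=2..T. \<Sum>t=1..T. if r \<in> {block_start \<Delta> t + 1..t} then g r else 0)"
    by (rule sum.swap)
  also have "\<dots> \<le> (\<Sum>r=2..T. real \<Delta> * g r)"
  proof (rule sum_mono)
    fix r
    have "{t \<in> {1..T}. r \<in> {block_start \<Delta> t + 1..t}} \<subseteq> {r..<r + \<Delta>}"
    proof
      fix t assume "t \<in> {t \<in> {1..T}. r \<in> {block_start \<Delta> t + 1..t}}"
      then show "t \<in> {r..<r + \<Delta>}"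
        using block_start_bounds(3)[OF assms(1), of t] by auto
    qed
    then have card: "card {t \<in> {1..T}. r \<in> {block_start \<Delta> t + 1..t}} \<le> card {r..<r + \<Delta>}"
      by (intro card_mono) auto
    have "(\<Sum>t=1..T. if r \<in> {block_start \<Delta> t + 1..t} then g r else 0)
        = (\<Sum>t\<in>{t \<in> {1..T}. r \<in> {block_start \<Delta> t + 1..t}}. g r)"
      by (rule sum.inter_filter[symmetric]) simp
    also have "\<dots> = real (card {t \<in> {1..T}. r \<in> {block_start \<Delta> t + 1..t}}) * g r"
      by simp
    also have "real (card {t \<in> {1..T}. r \<in> {block_start \<Delta> t + 1..t}}) * g r \<le> real \<Delta> * g r"
      using assms card by (intro mult_right_mono) auto
    finally show "(\<Sum>t=1..T. if r \<in> {block_start \<Delta> t + 1..t} then g r else 0) \<le> real \<Delta> * g r" .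
  qed
  finally show ?thesis
    by (simp flip: sum_distrib_left)
qed

text \<open>With \<open>s\<close> the start of the block, \<open>u s\<close> is optimal for
  \<open>F s\<close>. Replacing \<open>F t\<close> by \<open>F s\<close> costs the drift since
  \<open>s\<close> at both points \<open>u s\<close> and \<open>u t\<close>, hence the factor
  2.\<close>

lemma block_comparator_excess:
  fixes F :: "nat \<Rightarrow> 'a \<Rightarrow> real" and \<mu> :: "nat \<Rightarrow> real ^ 'k::finite"
  assumes "1 \<le> \<Delta>" "0 \<le> B"
    and min: "\<And>t. t \<in> {1..T} \<Longrightarrow> is_arg_min (F t) (\<lambda>y. y \<in> X) (u t)"
    and lip: "\<And>s t y. y \<in> X \<Longrightarrow> \<bar>F t y - F s y\<bar> \<le> B * norm1 (\<mu> t - \<mu> s)"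
  shows "(\<Sum>t=1..T. F t (u (block_start \<Delta> t)) - F t (u t))
    \<le> 2 * B * real \<Delta> * (\<Sum>t=2..T. norm1 (\<mu> t - \<mu> (t - 1)))"
proof -
  have "(\<Sum>t=1..T. F t (u (block_start \<Delta> t)) - F t (u t))
      \<le> (\<Sum>t=1..T. 2 * B * (\<Sum>r=block_start \<Delta> t + 1..t. norm1 (\<mu> r - \<mu> (r - 1))))"
  proof (rule sum_mono)
    fix t assume t: "t \<in> {1..T}"
    define s where "s = block_start \<Delta> t"
    have s: "s \<in> {1..T}" "s \<le> t"
      using block_start_bounds[OF assms(1), of t] t by (auto simp: s_def)
    have u: "u s \<in> X" "u t \<in> X" "F s (u s) \<le> F s (u t)"
      using min[OF s(1)] min[OF t] by (auto simp: is_arg_min_def not_less)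
    have "F t (u s) - F t (u t) \<le> 2 * (B * norm1 (\<mu> t - \<mu> s))"
      using lip[OF u(1), of t s] lip[OF u(2), of t s] u(3) by linarith
    also have "\<dots> \<le> 2 * (B * (\<Sum>r=s + 1..t. norm1 (\<mu> r - \<mu> (r - 1))))"
      using assms(2) norm1_diff_le_variation[OF s(2), of \<mu>] by (intro mult_left_mono) auto
    finally show "F t (u (block_start \<Delta> t)) - F t (u t)
        \<le> 2 * B * (\<Sum>r=block_start \<Delta> t + 1..t. norm1 (\<mu> r - \<mu> (r - 1)))"
      by (simp add: s_def)
  qed
  also have "\<dots> = 2 * B * (\<Sum>t=1..T. \<Sum>r=block_start \<Delta> t + 1..t. norm1 (\<mu> r - \<mu> (r - 1)))"
    by (simp flip: sum_distrib_left)
  also have "\<dots> \<le> 2 * B * (real \<Delta> * (\<Sum>r=2..T. norm1 (\<mu> r - \<mu> (r - 1))))"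
    using assms by (intro mult_left_mono sum_block_variation_le norm1_nonneg) auto
  finally show ?thesis
    by (simp add: mult.assoc)
qed

text \<open>The block length \<open>\<Delta> = \<lceil>R / L\<rceil>\<close> balances the cost \<open>\<Delta> * L\<close> of the comparators against the
  regret \<open>sqrt (T / \<Delta>) * V\<close>; it is at most the horizon unless \<open>T * L \<le> R\<close>.\<close>

lemma block_length_tradeoff:
  fixes L V \<delta> K :: real and T :: nat
  defines "R \<equiv> L powr (1/3) * real T powr (1/3) * V powr (2/3)"
  assumes \<delta>: "\<delta> > 0" "L \<ge> \<delta>" "V \<ge> \<delta>" and T: "1 \<le> T" and K: "1 \<le> K"
    and LV: "L\<^sup>2 \<le> K * real T * V\<^sup>2"
  shows "\<delta> \<le> R"
    and "real T * L \<le> R \<or> (\<exists>\<Delta>. 1 \<le> \<Delta> \<and> \<Delta> \<le> T \<and> real \<Delta> * L \<le> (1 + K) * R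
      \<and> sqrt (real ((T - 1) div \<Delta> + 1)) * V \<le> sqrt 2 * R)"
proof -
  have pos: "L > 0" "V > 0" "real T > 0"
    using \<delta> T by auto
  have R: "R > 0"
    using pos by (simp add: R_def)
  have cube: "R ^ 3 = L * real T * V\<^sup>2"
  proof -
    have "R ^ 3 = (L powr (1/3)) ^ 3 * (real T powr (1/3)) ^ 3 * (V powr (2/3)) ^ 3"
      by (simp add: R_def power_mult_distrib)
    also have "\<dots> = L * real T * V\<^sup>2"
      using pos by (simp add: powr_power)
    finally show ?thesis .
  qed
  have "\<delta> ^ 3 = \<delta> * 1 * \<delta>\<^sup>2"
    by (simp add: power2_eq_square power3_eq_cube)
  also have "\<dots> \<le> L * real T * V\<^sup>2"
    using \<delta> T pos by (intro mult_mono power_mono) auto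
  finally show "\<delta> \<le> R"
    using R \<delta> by (simp add: power_mono_iff flip: cube)
  \<comment> \<open>Rounding the block length up adds at most one further \<open>L\<close>; bounding
    it by \<open>K * R\<close> is the source of the factor \<open>1 + K\<close>.\<close>
  have "L ^ 3 = L\<^sup>2 * L"
    by (simp add: power2_eq_square power3_eq_cube)
  also have "\<dots> \<le> K * real T * V\<^sup>2 * L"
    using LV pos by (intro mult_right_mono) auto
  also have "\<dots> = K * R ^ 3"
    by (simp add: cube)
  also have "\<dots> \<le> K ^ 3 * R ^ 3"
    using R K by (intro mult_right_mono self_le_power) auto
  finally have LR: "L \<le> K * R"
    unfolding power_mult_distrib[symmetric] using R K
    by (intro power_le_imp_le_base[of L 2]) (auto simp: numeral_3_eq_3)
  show "real T * L \<le> R \<or> (\<exists>\<Delta>. 1 \<le> \<Delta> \<and> \<Delta> \<le> T \<and> real \<Delta> * L \<le> (1 + K) * R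
      \<and> sqrt (real ((T - 1) div \<Delta> + 1)) * V \<le> sqrt 2 * R)"
  proof (cases "real T * L \<le> R")
    case False
    define \<Delta> where "\<Delta> = nat \<lceil>R / L\<rceil>"
    have RL: "R / L > 0"
      using R pos by simp
    then have D: "R / L \<le> real \<Delta>" "real \<Delta> \<le> R / L + 1" "1 \<le> \<Delta>"
      unfolding \<Delta>_def by linarith+
    have "R / L < real T"
      using False pos by (simp add: divide_less_eq)
    then have DT: "\<Delta> \<le> T"
      unfolding \<Delta>_def by linarith
    have "real \<Delta> * L \<le> (R / L + 1) * L"
      using D pos by (intro mult_right_mono) auto
    also have "\<dots> = R + L"
      using pos by (simp add: field_simps)
    finally have 1: "real \<Delta> * L \<le> (1 + K) * R"
      using LR by (simp add: algebra_simps)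
    have "real ((T - 1) div \<Delta> + 1) \<le> real (T - 1) / real \<Delta> + 1"
      using of_nat_div_le_of_nat[of "T - 1" \<Delta>, where 'a = real] by simp
    \<comment> \<open>The incomplete last block is charged as \<open>T / \<Delta>\<close>, which is
      at least 1 because \<Delta> does not exceed \<open>T\<close>.\<close>
    also have "\<dots> \<le> real T / real \<Delta> + real T / real \<Delta>"
      using D DT by (intro add_mono divide_right_mono) auto
    also have "\<dots> = 2 * real T / real \<Delta>"
      by simp
    also have "\<dots> \<le> 2 * real T / (R / L)"
      using D RL by (intro divide_left_mono mult_pos_pos) auto
    finally have "real ((T - 1) div \<Delta> + 1) * V\<^sup>2 \<le> 2 * real T / (R / L) * V\<^sup>2"
      by (intro mult_right_mono) auto
    also have "\<dots> = 2 * R ^ 3 / R"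
      by (simp add: cube)
    also have "\<dots> = 2 * R\<^sup>2"
      using R by (simp add: power2_eq_square power3_eq_cube)
    finally have "sqrt (real ((T - 1) div \<Delta> + 1) * V\<^sup>2) \<le> sqrt (2 * R\<^sup>2)"
      by (rule real_sqrt_le_mono)
    then have 2: "sqrt (real ((T - 1) div \<Delta> + 1)) * V \<le> sqrt 2 * R"
      using R pos by (simp add: real_sqrt_mult)
    show ?thesis
      using 1 2 D DT by blast
  qed simp
qed

section \<open>Expected regret under label shift\<close>

text \<open>All factors of \<open>q\<close> are at least 1, so each summand is at most
  \<open>q\<close>, and the coefficients add up to 27 + 8 + 2 + 2 = 39. The first bound serves the
  block argument, the second the fallback.\<close>

lemma ols_const_bounds:
  fixes D G B \<delta> :: real and K N :: nat
  assumes "0 \<le> D" "0 \<le> G" "0 \<le> B" "0 < \<delta>" "1 \<le> K" "1 \<le> N"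
  shows "27 * (1 + ln (real N)) * (1 + D) * (1 + G) * real K * (1 + 1 / \<delta>) + 8 * G\<^sup>2 * D\<^sup>2 / \<delta>
           + 2 * B * (1 + real K) \<le> ols_const D G B K \<delta> N" (is ?main)
    and "G * D / \<delta> \<le> ols_const D G B K \<delta> N" (is ?trivial)
proof -
  define a where "a = 1 + D"
  define c where "c = 1 + G"
  define e where "e = 1 + 1 / \<delta>"
  define n where "n = 1 + ln (real N)"
  have ge: "1 \<le> a" "1 \<le> c" "1 \<le> e" "1 \<le> n" "1 \<le> 1 + B" "1 \<le> real K"
    using assms by (auto simp: a_def c_def e_def n_def)
  have one: "1 \<le> x * y" if "1 \<le> x" "1 \<le> y" for x y :: real
    using mult_mono[OF that] that by simp
  have grow: "x \<le> x * y" if "0 \<le> x" "1 \<le> y" for x y :: real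
    using mult_left_mono[OF that(2,1)] by simp
  define q where "q = a\<^sup>2 * c\<^sup>2 * (1 + B) * real K * e * n"
  have "n * a * c * real K * e \<le> n * a * c * real K * e * (a * c * (1 + B))"
    using ge by (intro grow one) auto
  also have "\<dots> = q"
    by (simp add: q_def power2_eq_square mult_ac)
  finally have 1: "n * a * c * real K * e \<le> q" .
  have GD: "G\<^sup>2 * D\<^sup>2 / \<delta> \<le> c\<^sup>2 * a\<^sup>2 * e" "G * D / \<delta> \<le> c * a * e"
    unfolding divide_inverse a_def c_def e_def using assms
    by (intro mult_mono power_mono; simp add: field_simps)+
  have "c\<^sup>2 * a\<^sup>2 * e \<le> c\<^sup>2 * a\<^sup>2 * e * ((1 + B) * real K * n)"
    using ge by (intro grow one) auto
  also have "\<dots> = q"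
    by (simp add: q_def mult_ac)
  finally have 2: "G\<^sup>2 * D\<^sup>2 / \<delta> \<le> q"
    using GD by linarith
  have "c * a * e \<le> c * a * e * (a * c * (1 + B) * real K * n)"
    using ge by (intro grow one) auto
  also have "\<dots> = q"
    by (simp add: q_def power2_eq_square mult_ac)
  finally have 4: "G * D / \<delta> \<le> q"
    using GD by linarith
  have "(1 + B) * real K \<le> (1 + B) * real K * (a\<^sup>2 * c\<^sup>2 * e * n)"
    using ge by (intro grow one one_le_power) auto
  also have "\<dots> = q"
    by (simp add: q_def mult_ac)
  finally have "(1 + B) * real K \<le> q" .
  moreover have "B * real K \<le> (1 + B) * real K" "B * 1 \<le> B * real K"
    using assms ge by (intro mult_right_mono mult_left_mono; simp)+
  ultimately have 3: "B * real K \<le> q" "B \<le> q"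
    by linarith+
  have q: "ols_const D G B K \<delta> N = 1000 * q"
    by (simp add: ols_const_def q_def a_def c_def e_def n_def)
  have "0 \<le> q"
    using 3 assms by linarith
  then show ?trivial
    using 4 by (simp add: q)
  have "27 * u + 8 * v + 2 * (w + z) \<le> 1000 * q" if "u \<le> q" "v \<le> q" "w \<le> q" "z \<le> q" for u v w z
    using that \<open>0 \<le> q\<close> by argo
  from this[OF 1 2 3(2,1)]
  have "27 * (n * a * c * real K * e) + 8 * (G\<^sup>2 * D\<^sup>2 / \<delta>) + 2 * (B + B * real K) \<le> 1000 * q" .
  then show ?main
    unfolding q by (simp add: a_def c_def e_def n_def algebra_simps)
qed

theorem corollary4:
  fixes M :: "'w measure"
    and X :: "'a::euclidean_space set"
    and Z :: "'z::euclidean_space set"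
    and P :: "nat \<Rightarrow> ('z \<times> 'k::finite) measure"
    and U :: "'p::real_vector set"
    and h :: "'a \<Rightarrow> 'z \<Rightarrow> 'p"
    and l :: "'p \<Rightarrow> 'k \<Rightarrow> real"
    and S0 :: "('z \<times> 'k) list"
    and h0 :: "'z \<Rightarrow> 'k"
    and T :: nat
    and m :: "nat \<Rightarrow> nat"
    and zs :: "nat \<Rightarrow> nat \<Rightarrow> 'w \<Rightarrow> 'z"
    and D G B \<delta> :: real
    and xref :: 'a
    and xinit :: "nat \<Rightarrow> 'a"
    and x xh :: "'w \<Rightarrow> nat \<Rightarrow> nat \<Rightarrow> 'a"
    and p :: "'w \<Rightarrow> nat \<Rightarrow> nat \<Rightarrow> real"
    and xstar :: "nat \<Rightarrow> 'a"
  defines "\<mu> \<equiv> \<lambda>t. label_vec (P t)"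
    and "F \<equiv> expected_fun Z P h l"
    and "S \<equiv> \<lambda>t \<omega>. map (\<lambda>n. zs t n \<omega>) [0..<m t]"
    and "N \<equiv> num_experts T G"
  defines "\<mu>hat \<equiv> \<lambda>t \<omega>. label_est S0 h0 (S t \<omega>)"
    and "f \<equiv> \<lambda>\<omega> t. random_fun S0 h0 h l (S t \<omega>)"
    and "L \<equiv> (\<Sum>t=2..T. norm1 (\<mu> t - \<mu> (t - 1)))"
  defines "V \<equiv> sqrt (\<Sum>t=1..T. \<integral>\<omega>. (norm (\<mu>hat t \<omega> - \<mu> t))\<^sup>2 \<partial>M)
             + sqrt (\<Sum>t=1..T. \<integral>\<omega>. (norm (\<mu> t - \<mu> (t - 1)))\<^sup>2 \<partial>M)"
    \<comment> \<open>the distributions, related by label shift\<close>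
  assumes P_prob: "\<And>t. t \<le> T \<Longrightarrow> prob_space (P t)"
    and P_sets: "\<And>t. t \<le> T \<Longrightarrow> sets (P t) = sets (feature_space Z \<Otimes>\<^sub>M count_space UNIV)"
    and P_label: "\<And>k. label_vec (P 0) $ k > 0"
    and P_shift: "\<And>t k. t \<le> T \<Longrightarrow> label_vec (P t) $ k > 0 \<Longrightarrow>
                    class_cond Z (P t) k = class_cond Z (P 0) k"
    \<comment> \<open>parameters, prediction function and loss\<close>
    and X: "convex X" "0 \<in> X" "bounded X" "diameter X \<le> D"
    and surrogate: "convex U" "\<And>y z. y \<in> X \<Longrightarrow> z \<in> Z \<Longrightarrow> h y z \<in> U"
                   "\<And>k. convex_on U (\<lambda>u. l u k)"
    and loss_meas: "\<And>y k. y \<in> X \<Longrightarrow> (\<lambda>z. l (h y z) k) \<in> borel_measurable (feature_space Z)"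
    and loss_bdd: "bdd_above ((\<lambda>(z, k, y). \<bar>l (h y z) k\<bar>) ` (Z \<times> UNIV \<times> X))"
    and B: "B = (SUP (z, k, y)\<in>Z \<times> UNIV \<times> X. \<bar>l (h y z) k\<bar>)"
    and F0_grad: "\<And>k. gradient_bounded_on X G (class_risk Z (P 0) h l k)"
    \<comment> \<open>the labelled sample and the initial classifier\<close>
    and S0: "set S0 \<subseteq> Z \<times> UNIV"
    and h0_meas: "h0 \<in> feature_space Z \<rightarrow>\<^sub>M count_space UNIV"
    and C_inv: "invertible (confusion Z (P 0) h0)"
    and C_exact: "emp_confusion S0 h0 = confusion Z (P 0) h0"
    and f0_exact: "\<And>k. class_avg S0 h l k = class_risk Z (P 0) h l k"
    \<comment> \<open>the unlabelled samples and the resulting random functions\<close>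
    and M: "prob_space M"
    and m_pos: "\<And>t. t \<in> {1..T} \<Longrightarrow> m t \<ge> 1"
    and zs_indep: "prob_space.indep_vars M (\<lambda>_. feature_space Z) (\<lambda>(t, n). zs t n)
                     {(t, n). t \<in> {1..T} \<and> n < m t}"
    and zs_law: "\<And>t n. t \<in> {1..T} \<Longrightarrow> n < m t \<Longrightarrow>
                   distr M (feature_space Z) (zs t n) = distr (P t) (feature_space Z) fst"
    and f_convex: "\<And>t \<omega>. t \<in> {1..T} \<Longrightarrow> \<omega> \<in> space M \<Longrightarrow> convex_on X (f \<omega> t)"
    and f_grad: "\<And>t \<omega>. t \<in> {1..T} \<Longrightarrow> \<omega> \<in> space M \<Longrightarrow> gradient_bounded_on X G (f \<omega> t)"
    \<comment> \<open>the algorithm, started at a non-random point, and the comparators\<close>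
    and xref: "xref \<in> X"
    and init: "\<And>\<omega> i. \<omega> \<in> space M \<Longrightarrow> i \<in> {1..N} \<Longrightarrow> x \<omega> 1 i = xinit i"
    and run: "\<And>\<omega>. \<omega> \<in> space M \<Longrightarrow> two_layer_run X D G T xref (f \<omega>) (x \<omega>) (xh \<omega>) (p \<omega>)"
    and xstar: "\<And>t. t \<in> {1..T} \<Longrightarrow> is_arg_min (F t) (\<lambda>y. y \<in> X) (xstar t)"
    \<comment> \<open>the regime of the asymptotic bound\<close>
    and nondegenerate: "\<delta> > 0" "L \<ge> \<delta>" "V \<ge> \<delta>"
  shows "(\<integral>\<omega>. (\<Sum>t=1..T. f \<omega> t (played N (x \<omega> t) (p \<omega> t))) - (\<Sum>t=1..T. f \<omega> t (xstar t)) \<partial>M)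
           \<le> ols_const D G B CARD('k) \<delta> N *
               (L powr (1/3) * real T powr (1/3) * V powr (2/3))"
proof -

  \<comment> \<open>Losses and expected functions as combinations of the class risks\<close>
  interpret prob_space M
    by fact
  let ?K = "real CARD('k)"
  have K: "?K \<ge> 1"
    by (simp add: Suc_le_eq)
  have zs_meas: "zs t n \<in> M \<rightarrow>\<^sub>M feature_space Z" if "t \<in> {1..T}" "n < m t" for t n
  proof -
    have "(t, n) \<in> {(t, n). t \<in> {1..T} \<and> n < m t}"
      using that by simp
    with zs_indep have "(case (t, n) of (t, n) \<Rightarrow> zs t n) \<in> M \<rightarrow>\<^sub>M feature_space Z"
      unfolding indep_vars_def2 by blast
    then show ?thesis
      by simp
  qed
  interpret LS: label_stream M Z P S0 h0 T m zs
    by (intro label_stream.intro label_stream_axioms.intro prob_space_axioms)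
      (rule P_prob P_sets P_shift h0_meas C_inv C_exact m_pos zs_meas zs_law; assumption)+
  define g where "g = (\<lambda>k. class_risk Z (P 0) h l k)"
  have est: "\<mu>hat t \<omega> = LS.est t \<omega>" for t \<omega>
    by (simp add: \<mu>hat_def LS.est_def LS.sample_def S_def)
  have f: "f \<omega> t y = (\<Sum>k\<in>UNIV. LS.est t \<omega> $ k * g k y)" for \<omega> t y
    by (simp add: f_def random_fun_def LS.est_def LS.sample_def S_def g_def f0_exact)
  have F: "F t y = (\<Sum>k\<in>UNIV. \<mu> t $ k * g k y)" for t y
    by (simp add: F_def expected_fun_def \<mu>_def g_def)
  have g_grad: "GDERIV (g k) y :> gradient (g k) y" "norm (gradient (g k) y) \<le> G" if "y \<in> X" for k y
    using F0_grad[of k] that by (auto simp: gradient_bounded_on_def g_def intro: GDERIV_gradient)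
  have G: "0 \<le> G"
    using order_trans[OF norm_ge_zero g_grad(2)[OF X(2)]] .
  have D: "0 \<le> D"
    using X(4) diameter_ge_0[OF X(3)] by linarith
  have diam: "norm (y - z) \<le> D" if "y \<in> X" "z \<in> X" for y z
    using diameter_bounded_bound[OF X(3) that] X(4) by (simp add: dist_norm)
  have P0: "prob_space (P 0)" "sets (P 0) = sets (feature_space Z \<Otimes>\<^sub>M count_space UNIV)"
    using P_prob P_sets by auto
  have "space (P 0) = Z \<times> UNIV"
    using sets_eq_imp_space_eq[OF P0(2)] by (simp add: space_pair_measure)
  then obtain z0 where z0: "z0 \<in> Z"
    using prob_space.not_empty[OF P0(1)] by auto
  have loss: "\<bar>l (h y z) k\<bar> \<le> B" if "z \<in> Z" "y \<in> X" for y z k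
  proof -
    have "(\<lambda>(z, k, y). \<bar>l (h y z) k\<bar>) (z, k, y) \<le> B"
      unfolding B using that by (intro cSUP_upper loss_bdd) auto
    then show ?thesis
      by simp
  qed
  have B0: "0 \<le> B"
    using order_trans[OF abs_ge_zero loss[OF z0 X(2)]] .
  have g_bound: "\<bar>g k y\<bar> \<le> B" if "y \<in> X" for k y
    unfolding g_def using loss that B0 by (intro abs_class_risk_le P0 P_label) auto
  have T: "1 \<le> T"
    using nondegenerate unfolding L_def by (cases T) auto
  have TL: "two_layer X D G T xref (f \<omega>) (x \<omega>) (xh \<omega>) (p \<omega>)" if "\<omega> \<in> space M" for \<omega>
    by unfold_locales
      (rule X(1) diam f_convex[OF _ that] f_grad[OF _ that] xref run[OF that]; assumption)+
  have N: "1 \<le> N"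
    by (simp add: N_def num_experts_def)

  \<comment> \<open>The relation between \<open>L\<close>, \<open>V\<close> and the rate
    \<open>R\<close>\<close>
  define E where "E = (\<Sum>t=1..T. expectation (\<lambda>\<omega>. (norm (LS.est t \<omega> - label_vec (P t)))\<^sup>2))"
  define Q where "Q = (\<Sum>t=1..T. (norm (label_vec (P t) - label_vec (P (t - 1))))\<^sup>2)"
  have EQ: "0 \<le> E" "0 \<le> Q"
    by (auto simp: E_def Q_def intro!: sum_nonneg)
  have V: "V = sqrt E + sqrt Q"
    by (simp add: V_def est E_def Q_def \<mu>_def prob_space)
  have V2: "E + Q \<le> V\<^sup>2"
    using EQ by (simp add: V power2_sum)
  have "L\<^sup>2 \<le> ?K * real T * Q"
    unfolding L_def Q_def \<mu>_def by (rule sum_norm1_square_le)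
  also have "\<dots> \<le> ?K * real T * V\<^sup>2"
    using V2 EQ by (intro mult_left_mono) auto
  finally have LV: "L\<^sup>2 \<le> ?K * real T * V\<^sup>2" .
  define R where "R = L powr (1/3) * real T powr (1/3) * V powr (2/3)"
  note tradeoff = block_length_tradeoff[OF nondegenerate T K LV, folded R_def]
  have R: "0 < R" "1 \<le> R / \<delta>"
    using tradeoff(1) nondegenerate(1) by auto
  define regret where
    "regret \<omega> = (\<Sum>t=1..T. f \<omega> t (played N (x \<omega> t) (p \<omega> t))) - (\<Sum>t=1..T. f \<omega> t (xstar t))" for \<omega>
  note const = ols_const_bounds[OF D G B0 nondegenerate(1) _ N, of "CARD('k)"]
  have C: "0 \<le> ols_const D G B CARD('k) \<delta> N"
  proof (rule order_trans)
    show "0 \<le> G * D / \<delta>"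
      using D G nondegenerate(1) by simp
  qed (use const(2) K in simp)
  have "expectation regret \<le> ols_const D G B CARD('k) \<delta> N * R"
  proof (cases "integrable M regret")
    \<comment> \<open>the runs are not assumed measurable in \<open>\<omega>\<close>; a non-integrable regret has integral \<open>0\<close>\<close>
    case False
    then show ?thesis
      using C R by (simp add: not_integrable_integral_eq)
  next
    case int: True
    have xstar_in: "xstar t \<in> X" if "t \<in> {1..T}" for t
      using xstar[OF that] by (simp add: is_arg_min_def)
    show ?thesis
    \<comment> \<open>In the first alternative even the bound \<open>G * D\<close> per round
      suffices, as \<open>T * \<delta>\<close> is at most \<open>T * L\<close>. For
      \<open>D = 0\<close> the step sizes vanish, but so does this bound.\<close>
    proof (cases "real T * L \<le> R \<or> D = 0")
      case True
      have "regret \<omega> \<le> real T * (G * D)" if "\<omega> \<in> space M" for \<omega>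
      proof -
        have "regret \<omega> = (\<Sum>t=1..T. f \<omega> t (played N (x \<omega> t) (p \<omega> t)) - f \<omega> t (xstar t))"
          by (simp add: regret_def sum_subtractf)
        also have "\<dots> \<le> (\<Sum>t=1..T. G * D)"
          using two_layer.instantaneous_regret_le[OF TL[OF that] _ xstar_in]
          by (intro sum_mono) (auto simp: N_def)
        finally show ?thesis
          by simp
      qed
      then have "expectation regret \<le> real T * (G * D)"
        by (intro integral_le_const int) auto
      also have "\<dots> \<le> G * D / \<delta> * R"
      proof (cases "D = 0")
        case False
        have "real T * \<delta> \<le> real T * L"
          using nondegenerate by (intro mult_left_mono) auto
        also have "\<dots> \<le> R"
          using True False by simp
        finally have "G * D * (real T * \<delta>) \<le> G * D * R"
          using D G by (intro mult_left_mono) auto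
        then show ?thesis
          using nondegenerate(1) by (simp add: field_simps)
      qed simp
      also have "\<dots> \<le> ols_const D G B CARD('k) \<delta> N * R"
        using const(2) K R by (intro mult_right_mono) auto
      finally show ?thesis .
    next

      \<comment> \<open>Comparators that are constant on blocks\<close>
      case False
      then obtain \<Delta> where \<Delta>: "1 \<le> \<Delta>" "\<Delta> \<le> T" "real \<Delta> * L \<le> (1 + ?K) * R"
        "sqrt (real ((T - 1) div \<Delta> + 1)) * V \<le> sqrt 2 * R"
        using tradeoff(2) by blast
      have Dpos: "D > 0"
        using False D by simp
      define n where "n = (T - 1) div \<Delta> + 1"
      define u where "u t = xstar (block_start \<Delta> t)" for t
      have u_in: "u t \<in> X" if "t \<in> {1..T}" for t
        using block_start_bounds[OF \<Delta>(1), of t] that by (auto simp: u_def intro!: xstar_in)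
      define W where "W \<omega> = (\<Sum>t=1..T. (LS.grad_step G \<omega> t)\<^sup>2)" for \<omega>
      have W0: "0 \<le> W \<omega>" for \<omega>
        by (simp add: W_def sum_nonneg)
      \<comment> \<open>The loss of the block comparators over the minimisers, written so that
        linearity in the estimates with non-random coefficients is visible.\<close>
      define excess where
        "excess \<omega> = (\<Sum>t=1..T. \<Sum>k\<in>UNIV. LS.est t \<omega> $ k * (g k (u t) - g k (xstar t)))" for \<omega>

      have "(T - 1) div \<Delta> \<le> T - 1"
        by (rule div_le_dividend)
      then have n: "(T - 1) div \<Delta> < T" "1 \<le> n"
        using T unfolding n_def by linarith+
      \<comment> \<open>Since \<open>n\<close> is at least 1, the meta regret can carry the factor
        \<open>sqrt n\<close> of the base regret. The coefficients 4 of the former and 3/2 of the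
        latter add up to 11/2, rounded to 6.\<close>
      define c1 where "c1 = 6 * (1 + ln (real N)) * (1 + D) * sqrt (real n)"
      have c1: "0 \<le> c1"
        using N D by (simp add: c1_def)

      \<comment> \<open>The regret bound for a single outcome\<close>
      have pathwise: "regret \<omega> \<le> c1 * sqrt (1 + W \<omega>) + 8 * G\<^sup>2 * D\<^sup>2 + excess \<omega>" if \<omega>: "\<omega> \<in> space M" for \<omega>
      proof -
        interpret A: two_layer X D G T xref "f \<omega>" "x \<omega>" "xh \<omega>" "p \<omega>"
          by (rule TL[OF \<omega>])
        have f_gradient: "gradient (f \<omega> t) y = (\<Sum>k\<in>UNIV. LS.est t \<omega> $ k *\<^sub>R gradient (g k) y)"
          if "y \<in> X" for t y
        proof -
          have "f \<omega> t = (\<lambda>y. \<Sum>k\<in>UNIV. LS.est t \<omega> $ k * g k y)"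
            by (simp add: f fun_eq_iff)
          moreover have "GDERIV (\<lambda>y. \<Sum>k\<in>UNIV. LS.est t \<omega> $ k * g k y) y :>
              (\<Sum>k\<in>UNIV. LS.est t \<omega> $ k *\<^sub>R gradient (g k) y)"
            by (intro GDERIV_sum GDERIV_cmult g_grad that)
          ultimately show ?thesis
            by (simp add: GDERIV_imp_gradient)
        qed
        have step: "norm (gradient (f \<omega> t) y - gradient (f \<omega> (t - 1)) y) \<le> LS.grad_step G \<omega> t"
          if t: "t \<in> {2..T}" and y: "y \<in> X" for t y
        proof -
          have "norm (gradient (f \<omega> t) y - gradient (f \<omega> (t - 1)) y)
              = norm (\<Sum>k\<in>UNIV. (LS.est t \<omega> - LS.est (t - 1) \<omega>) $ k *\<^sub>R gradient (g k) y)"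
            by (simp add: f_gradient y scaleR_diff_left sum_subtractf)
          also have "\<dots> \<le> (\<Sum>k\<in>UNIV. \<bar>(LS.est t \<omega> - LS.est (t - 1) \<omega>) $ k\<bar> * G)"
            using g_grad(2)[OF y] by (intro sum_norm_le) (simp add: mult_left_mono)
          also have "\<dots> = G * norm1 (LS.est t \<omega> - LS.est (t - 1) \<omega>)"
            by (simp add: norm1_def mult.commute[of _ G] sum_distrib_left)
          also have "\<dots> \<le> G * (sqrt ?K * norm (LS.est t \<omega> - LS.est (t - 1) \<omega>))"
            using G by (intro mult_left_mono norm1_le_norm)
          finally have 1: "norm (gradient (f \<omega> t) y - gradient (f \<omega> (t - 1)) y)
              \<le> sqrt ?K * G * norm (LS.est t \<omega> - LS.est (t - 1) \<omega>)"
            by (simp add: mult_ac)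
          have "norm (gradient (f \<omega> t) y) \<le> G" "norm (gradient (f \<omega> (t - 1)) y) \<le> G"
            using t y by (auto intro!: A.gderiv(2))
          then have 2: "norm (gradient (f \<omega> t) y - gradient (f \<omega> (t - 1)) y) \<le> 2 * G"
            using norm_triangle_ineq4[of "gradient (f \<omega> t) y" "gradient (f \<omega> (t - 1)) y"] by linarith
          show ?thesis
            using 1 2 t by (simp add: LS.grad_step_def)
        qed
        have "(\<Sum>t=1..T. f \<omega> t (played N (x \<omega> t) (p \<omega> t)) - f \<omega> t (u t))
            \<le> (4 + ln (real N)) * sqrt (1 + D\<^sup>2 * W \<omega>) + 8 * G\<^sup>2 * D\<^sup>2
              + 3 / 2 * D * sqrt (real n * (1 + W \<omega>))"
          unfolding N_def W_def n_def
        proof (rule A.dynamic_regret[where k = "\<lambda>t. (t - 1) div \<Delta>" and v = "\<lambda>j. xstar (j * \<Delta> + 1)"])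
          show "norm (gradient (f \<omega> 1) y) \<le> LS.grad_step G \<omega> 1" if "y \<in> X" for y
            using A.gderiv(2)[of 1 y] that T by (simp add: LS.grad_step_def)
          show "mono (\<lambda>t. (t - 1) div \<Delta>)"
            by (intro monoI div_le_mono) simp
        qed (use Dpos T step LS.grad_step_le[OF G] u_in n in \<open>auto simp: u_def block_start_def\<close>)
        also have "(4 + ln (real N)) * sqrt (1 + D\<^sup>2 * W \<omega>)
            \<le> (4 + ln (real N)) * ((1 + D) * (sqrt (real n) * sqrt (1 + W \<omega>)))"
        proof (rule mult_left_mono)
          have "1 + D\<^sup>2 * W \<omega> \<le> (1 + D)\<^sup>2 * (1 + W \<omega>)"
            using D W0[of \<omega>] by (simp add: power2_eq_square algebra_simps)
          also have "\<dots> \<le> (1 + D)\<^sup>2 * (real n * (1 + W \<omega>))"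
            using n W0[of \<omega>] mult_right_mono[of 1 "real n" "1 + W \<omega>"] by (intro mult_left_mono) auto
          finally show "sqrt (1 + D\<^sup>2 * W \<omega>) \<le> (1 + D) * (sqrt (real n) * sqrt (1 + W \<omega>))"
            using D real_sqrt_le_mono by (fastforce simp: real_sqrt_mult)
        qed (use N in simp)
        also have "3 / 2 * D * sqrt (real n * (1 + W \<omega>)) \<le> 3 / 2 * (1 + D) * (sqrt (real n) * sqrt (1 + W \<omega>))"
          using W0[of \<omega>] unfolding real_sqrt_mult by (intro mult_right_mono) auto
        also have "(4 + ln (real N)) * ((1 + D) * (sqrt (real n) * sqrt (1 + W \<omega>))) + 8 * G\<^sup>2 * D\<^sup>2
              + 3 / 2 * (1 + D) * (sqrt (real n) * sqrt (1 + W \<omega>))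
            = (11 / 2 + ln (real N)) * (1 + D) * sqrt (real n) * sqrt (1 + W \<omega>) + 8 * G\<^sup>2 * D\<^sup>2"
          by (simp add: algebra_simps)
        also have "\<dots> \<le> c1 * sqrt (1 + W \<omega>) + 8 * G\<^sup>2 * D\<^sup>2"
          unfolding c1_def using N D W0[of \<omega>] by (intro add_right_mono mult_right_mono) auto
        finally have "(\<Sum>t=1..T. f \<omega> t (played N (x \<omega> t) (p \<omega> t)) - f \<omega> t (u t))
            \<le> c1 * sqrt (1 + W \<omega>) + 8 * G\<^sup>2 * D\<^sup>2"
          by simp
        moreover have "excess \<omega> = (\<Sum>t=1..T. f \<omega> t (u t)) - (\<Sum>t=1..T. f \<omega> t (xstar t))"
          by (simp add: excess_def f right_diff_distrib sum_subtractf)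
        ultimately show ?thesis
          by (simp add: regret_def sum_subtractf)
      qed

      \<comment> \<open>Integrability of the pathwise bound\<close>
      have W_int: "integrable M W"
        unfolding W_def by (rule LS.grad_step_square_integrable[OF G])
      have sqrt_int: "integrable M (\<lambda>\<omega>. sqrt (1 + W \<omega>))"
      proof (rule Bochner_Integration.integrable_bound)
        show "integrable M (\<lambda>\<omega>. 1 + W \<omega>)"
          using W_int by simp
        have "sqrt (1 + W \<omega>) \<le> 1 + W \<omega>" for \<omega>
          using W0[of \<omega>] by (intro real_le_lsqrt) (auto simp: power2_eq_square algebra_simps)
        then show "AE \<omega> in M. norm (sqrt (1 + W \<omega>)) \<le> norm (1 + W \<omega>)"
          using W0 by auto
      qed (use W_int in auto)
      have excess_int: "integrable M excess"
        unfolding excess_def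
        by (intro Bochner_Integration.integrable_sum integrable_mult_left LS.est_nth_integrable)

      \<comment> \<open>The expected cost of the block comparators\<close>
      have "expectation excess = (\<Sum>t=1..T. \<Sum>k\<in>UNIV. expectation (\<lambda>\<omega>. LS.est t \<omega> $ k * (g k (u t) - g k (xstar t))))"
        unfolding excess_def
        by (subst Bochner_Integration.integral_sum, intro Bochner_Integration.integrable_sum
            integrable_mult_left LS.est_nth_integrable, assumption, intro sum.cong refl
            Bochner_Integration.integral_sum integrable_mult_left LS.est_nth_integrable)
      also have "\<dots> = (\<Sum>t=1..T. F t (u t) - F t (xstar t))"
      proof (rule sum.cong)
        fix t assume t: "t \<in> {1..T}"
        have "expectation (\<lambda>\<omega>. LS.est t \<omega> $ k * (g k (u t) - g k (xstar t)))
            = \<mu> t $ k * (g k (u t) - g k (xstar t))" for k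
          unfolding \<mu>_def LS.est_unbiased[OF t, symmetric]
          by (rule integral_mult_left_zero)
        then show "(\<Sum>k\<in>UNIV. expectation (\<lambda>\<omega>. LS.est t \<omega> $ k * (g k (u t) - g k (xstar t))))
            = F t (u t) - F t (xstar t)"
          by (simp add: F right_diff_distrib sum_subtractf)
      qed simp
      also have "\<dots> \<le> 2 * B * real \<Delta> * L"
        unfolding u_def L_def
      proof (rule block_comparator_excess[OF \<Delta>(1) B0 xstar])
        fix s t y assume "y \<in> X"
        have "\<bar>F t y - F s y\<bar> = \<bar>\<Sum>k\<in>UNIV. (\<mu> t - \<mu> s) $ k * g k y\<bar>"
          by (simp add: F left_diff_distrib sum_subtractf)
        also have "\<dots> \<le> (\<Sum>k\<in>UNIV. \<bar>(\<mu> t - \<mu> s) $ k\<bar> * B)"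
          using g_bound[OF \<open>y \<in> X\<close>]
          by (intro order_trans[OF sum_abs sum_mono]) (simp add: abs_mult mult_left_mono)
        also have "\<dots> = B * norm1 (\<mu> t - \<mu> s)"
          by (simp add: norm1_def mult.commute[of _ B] sum_distrib_left)
        finally show "\<bar>F t y - F s y\<bar> \<le> B * norm1 (\<mu> t - \<mu> s)" .
      qed
      also have "\<dots> \<le> 2 * B * ((1 + ?K) * R)"
        using \<Delta>(3) B0 by (simp add: mult.assoc mult_left_mono)
      finally have excess: "expectation excess \<le> 2 * B * (1 + ?K) * R"
        by (simp add: mult.assoc)

      \<comment> \<open>The expected root of the gradient variation\<close>
      have "expectation (\<lambda>\<omega>. sqrt (1 + W \<omega>)) \<le> (1 + G) * (1 + 3 * ?K * V)"
      proof (rule expectation_sqrt_le)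
        have "expectation (\<lambda>\<omega>. 1 + W \<omega>) = 1 + expectation W"
          using W_int by (simp add: prob_space)
        also have "\<dots> \<le> 1 + (G\<^sup>2 + 6 * ?K * G\<^sup>2 * (E + Q))"
          using LS.expectation_grad_steps_le[OF G T] by (simp add: W_def[abs_def] E_def Q_def)
        also have "\<dots> \<le> 1 + (G\<^sup>2 + 6 * ?K * G\<^sup>2 * V\<^sup>2)"
          using V2 by (intro add_left_mono mult_left_mono) auto
        \<comment> \<open>The 6 is raised to 9 so that, using \<open>K \<ge> 1\<close>, the bound
          fits under the square of \<open>1 + 3 * K * V\<close>.\<close>
        also have "\<dots> \<le> (1 + G\<^sup>2) * (1 + 9 * ?K * V\<^sup>2)"
          by (simp add: algebra_simps)
        also have "\<dots> \<le> (1 + G)\<^sup>2 * (1 + 3 * ?K * V)\<^sup>2"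
        proof (rule mult_mono)
          show "1 + G\<^sup>2 \<le> (1 + G)\<^sup>2"
            using G by (simp add: power2_sum)
          have "?K * V\<^sup>2 \<le> ?K * (?K * V\<^sup>2)"
            using K by (intro mult_left_mono) (auto simp: mult_le_cancel_right1)
          moreover have "0 \<le> ?K * V"
            using nondegenerate by simp
          ultimately have "1 + 9 * ?K * V\<^sup>2 \<le> 1 + 9 * (?K * (?K * V\<^sup>2)) + 6 * (?K * V)"
            by argo
          then show "1 + 9 * ?K * V\<^sup>2 \<le> (1 + 3 * ?K * V)\<^sup>2"
            by (simp add: power2_eq_square algebra_simps)
        qed auto
        finally show "expectation (\<lambda>\<omega>. 1 + W \<omega>) \<le> ((1 + G) * (1 + 3 * ?K * V))\<^sup>2"
          by (simp add: power_mult_distrib)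
        show "0 < (1 + G) * (1 + 3 * ?K * V)"
          using G nondegenerate by (intro mult_pos_pos add_pos_nonneg mult_nonneg_nonneg) auto
      qed (use W_int W0 in \<open>auto intro: add_nonneg_nonneg\<close>)
      also have "\<dots> \<le> (1 + G) * (3 * ?K * (1 + 1 / \<delta>) * V)"
      proof (intro mult_left_mono)
        \<comment> \<open>The constant 1 under the root leaves a term independent of
          \<open>V\<close>; the lower bound \<delta> on \<open>V\<close> makes it proportional to
          \<open>V\<close>.\<close>
        have "1 \<le> V / \<delta>"
          using nondegenerate by simp
        also have "\<dots> \<le> 3 * ?K * (V / \<delta>)"
        proof -
          have "1 * (V / \<delta>) \<le> 3 * ?K * (V / \<delta>)"
          proof (rule mult_right_mono)
            show "1 \<le> 3 * ?K"
              using K by linarith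
          qed (use nondegenerate in simp)
          then show ?thesis
            by simp
        qed
        finally show "1 + 3 * ?K * V \<le> 3 * ?K * (1 + 1 / \<delta>) * V"
          by (simp add: algebra_simps)
      qed (use G in simp)
      finally have sqrt_le: "expectation (\<lambda>\<omega>. sqrt (1 + W \<omega>)) \<le> (1 + G) * (3 * ?K * (1 + 1 / \<delta>) * V)" .

      \<comment> \<open>Assembling the constants\<close>
      have "expectation regret \<le> expectation (\<lambda>\<omega>. c1 * sqrt (1 + W \<omega>) + 8 * G\<^sup>2 * D\<^sup>2 + excess \<omega>)"
        using sqrt_int excess_int by (intro integral_mono int pathwise) auto
      also have "\<dots> = c1 * expectation (\<lambda>\<omega>. sqrt (1 + W \<omega>)) + 8 * G\<^sup>2 * D\<^sup>2 + expectation excess"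
        using sqrt_int excess_int by (simp add: prob_space)
      also have "\<dots> \<le> c1 * ((1 + G) * (3 * ?K * (1 + 1 / \<delta>) * V)) + 8 * G\<^sup>2 * D\<^sup>2 * (R / \<delta>)
          + 2 * B * (1 + ?K) * R"
        using mult_left_mono[OF R(2), of "8 * G\<^sup>2 * D\<^sup>2"] mult_left_mono[OF sqrt_le c1] excess by simp
      also have "c1 * ((1 + G) * (3 * ?K * (1 + 1 / \<delta>) * V))
          = 18 * (1 + ln (real N)) * (1 + D) * (1 + G) * ?K * (1 + 1 / \<delta>) * (sqrt (real n) * V)"
        by (simp add: c1_def)
      \<comment> \<open>18 is 6 from \<open>c1\<close> times 3 from the expected root. With
        \<open>sqrt 2\<close> rounded up to 3/2 it becomes the 27 of
        \<open>ols_const_bounds\<close>.\<close>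
      also have "\<dots> \<le> 18 * (1 + ln (real N)) * (1 + D) * (1 + G) * ?K * (1 + 1 / \<delta>) * (3 / 2 * R)"
      proof (rule mult_left_mono)
        have "sqrt 2 \<le> (3 / 2 :: real)"
          by (rule real_le_lsqrt) (auto simp: power2_eq_square)
        then have "sqrt 2 * R \<le> 3 / 2 * R"
          using R by (intro mult_right_mono) auto
        then show "sqrt (real n) * V \<le> 3 / 2 * R"
          using \<Delta>(4) unfolding n_def by linarith
      qed (use N D G nondegenerate in auto)
      also have "18 * (1 + ln (real N)) * (1 + D) * (1 + G) * ?K * (1 + 1 / \<delta>) * (3 / 2 * R)
          + 8 * G\<^sup>2 * D\<^sup>2 * (R / \<delta>) + 2 * B * (1 + ?K) * R
        = (27 * (1 + ln (real N)) * (1 + D) * (1 + G) * ?K * (1 + 1 / \<delta>) + 8 * G\<^sup>2 * D\<^sup>2 / \<delta>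
           + 2 * B * (1 + ?K)) * R"
        by (simp add: distrib_right)
      also have "\<dots> \<le> ols_const D G B CARD('k) \<delta> N * R"
        using const(1) K R by (intro mult_right_mono) auto
      finally show ?thesis
        by simp
    qed
  qed
  then show ?thesis
    by (simp add: regret_def[abs_def] R_def)
qed

end
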